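(* Consider a sequence of asymmetric hub models with $n_L\to\infty$, $n\to\infty$, $T\to\infty$, satisfying the standing assumption on $\rho$ in the context. Let $d,v\in(0,1]$ (possibly depending on the index of the sequence) be such that: (i) for each $i=1,\dots,n_L$ there exists a set $V_i\subset\{1,\dots,n\}$ with $|V_i|\ge vn/n_L$ and $A_{ij}-A_{i'j}\ge d$ for all $j\in V_i$ and all $i'\in\{1,\dots,n_L\}$, $i'\ne i$; (ii) $A_{ii'}\le c_0/n_L$ for all $i,i'\in\{1,\dots,n_L\}$, $i\ne i'$, where $c_0$ is a positive constant. If $(n_L^2\log n_L)/T=o(1)$, $(n_L^2\log T)/(d^2vT)=o(1)$ and $(n_L^2\log n_L)/(d^4v^2n)=o(1)$, then $$T_e/T=o_p(1).$$
   Context: Asymmetric hub model: nodes $1,\dots,n$; leaders (possible hubs) $1,\dots,n_L$ with $n_L\le n$; parameters $\rho=(\rho_1,\dots,\rho_{n_L})$ with $\rho_i\ge0$, $\sum_i\rho_i=1$, and $A\in[0,1]^{n_L\times n}$ with $A_{ii}=1$ for $i\le n_L$. Independently for $t=1,\dots,T$, a latent hub $z_*^{(t)}\in\{1,\dots,n_L\}$ is drawn with $\mathbb P(z_*^{(t)}=i)=\rho_i$, and given $z_*^{(t)}=i$ the variables $G_j^{(t)}\in\{0,1\}$, $j=1,\dots,n$, are independent with $\mathbb P(G_j^{(t)}=1\mid z_*^{(t)}=i)=A_{ij}$. Only $G$ is observed. Profile likelihood estimator: for an assignment $z=(z^{(1)},\dots,z^{(T)})\in\{1,\dots,n_L\}^T$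 let $t_i=\sum_t1(z^{(t)}=i)$, $\hat A^z_{ij}=\frac{1}{t_i}\sum_tG_j^{(t)}1(z^{(t)}=i)$, and $$L_G(z)=\sum_{t=1}^T\sum_{j=1}^n G_j^{(t)}\log\hat A^z_{z^{(t)},j}+(1-G_j^{(t)})\log(1-\hat A^z_{z^{(t)},j}),\qquad 0\log0=0.$$ An assignment is feasible if $G^{(t)}_{z^{(t)}}=1$ for every $t$ (the assigned hub appears in its group). $\hat z$ is a maximizer of $L_G(z)$ over feasible assignments. $T_e=\sum_t1(z_*^{(t)}\ne\hat z^{(t)})$ is the number of mislabeled groups. Asymptotics: $n_L,n,T,\rho,A,d,v$ all vary along a sequence; $o(1)$ and $o_p(1)$ are along this sequence, and "constant" means independent of the sequence index. Standing assumption: $\min_i\rho_i=c_{\min*}/n_L$ and $\max_i\rho_i=c_{\max*}/n_L$ with positive constants $c_{\min*},c_{\max*}$. *)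

theory Defs
  imports "HOL-Probability.Probability" "HOL-Library.Landau_Symbols"
begin

text \<open>
  Nodes are \<open>1, \<dots>, n\<close>, leaders are \<open>1, \<dots>, nL\<close>, and groups are \<open>1, \<dots>, T\<close>; values of
  the parameters and variables outside these ranges are unconstrained.  \<open>Z t\<close> is the latent
  hub of group \<open>t\<close>, and \<open>G t j\<close> says that node \<open>j\<close> belongs to group \<open>t\<close>.
  The guard \<open>\<rho> i > 0\<close> avoids conditioning on a null event.
\<close>

locale asymmetric_hub_model = prob_space M
  for M :: "'a measure" +
  fixes nL n T :: nat
    and \<rho> :: "nat \<Rightarrow> real"
    and A :: "nat \<Rightarrow> nat \<Rightarrow> real"
    and Z :: "nat \<Rightarrow> 'a \<Rightarrow> nat"
    and G :: "nat \<Rightarrow> nat \<Rightarrow> 'a \<Rightarrow> bool"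
  assumes nL_le_n: "nL \<le> n"
    and rho_nonneg: "\<And>i. i \<in> {1..nL} \<Longrightarrow> 0 \<le> \<rho> i"
    and rho_sum: "(\<Sum>i\<in>{1..nL}. \<rho> i) = 1"
    and A_range: "\<And>i j. i \<in> {1..nL} \<Longrightarrow> j \<in> {1..n} \<Longrightarrow> A i j \<in> {0..1}"
    and A_diag: "\<And>i. i \<in> {1..nL} \<Longrightarrow> A i i = 1"
    and indep_groups:
      "indep_vars (\<lambda>_. count_space UNIV \<Otimes>\<^sub>M (\<Pi>\<^sub>M j\<in>{1..n}. count_space UNIV))
         (\<lambda>t \<omega>. (Z t \<omega>, \<lambda>j\<in>{1..n}. G t j \<omega>)) {1..T}"
    and hub_prob:
      "\<And>t i. t \<in> {1..T} \<Longrightarrow> i \<in> {1..nL} \<Longrightarrow> \<P>(\<omega> in M. Z t \<omega> = i) = \<rho> i"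
    and cond_indep:
      "\<And>t i. t \<in> {1..T} \<Longrightarrow> i \<in> {1..nL} \<Longrightarrow> \<rho> i > 0 \<Longrightarrow>
         prob_space.indep_vars (uniform_measure M {\<omega> \<in> space M. Z t \<omega> = i})
           (\<lambda>_. count_space UNIV) (G t) {1..n}"
    and cond_member_prob:
      "\<And>t i j. t \<in> {1..T} \<Longrightarrow> i \<in> {1..nL} \<Longrightarrow> \<rho> i > 0 \<Longrightarrow> j \<in> {1..n} \<Longrightarrow>
         \<P>(\<omega> in M. G t j \<omega> \<bar> Z t \<omega> = i) = A i j"

definition group_count :: "nat \<Rightarrow> (nat \<Rightarrow> nat) \<Rightarrow> nat \<Rightarrow> nat" where
  "group_count T z i = card {t \<in> {1..T}. z t = i}"

definition A_hat :: "nat \<Rightarrow> (nat \<Rightarrow> nat \<Rightarrow> bool) \<Rightarrow> (nat \<Rightarrow> nat) \<Rightarrow> nat \<Rightarrow> nat \<Rightarrow> real" where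
  "A_hat T g z i j =
     1 / real (group_count T z i) * (\<Sum>t\<in>{1..T}. of_bool (g t j) * of_bool (z t = i))"

text \<open>
  The convention \<open>0 log 0 = 0\<close> needs no case distinction: \<open>ln\<close> is total, so a vanishing factor
  in front of it makes the term vanish.  A nonvanishing factor never meets \<open>ln 0\<close>, because
  group \<open>t\<close> itself contributes to \<open>A_hat T g z (z t) j\<close>.
\<close>

definition profile_loglik ::
    "nat \<Rightarrow> nat \<Rightarrow> (nat \<Rightarrow> nat \<Rightarrow> bool) \<Rightarrow> (nat \<Rightarrow> nat) \<Rightarrow> real" where
  "profile_loglik n T g z =
     (\<Sum>t\<in>{1..T}. \<Sum>j\<in>{1..n}.
        of_bool (g t j) * ln (A_hat T g z (z t) j)
        + (1 - of_bool (g t j)) * ln (1 - A_hat T g z (z t) j))"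

definition feasible :: "nat \<Rightarrow> nat \<Rightarrow> (nat \<Rightarrow> nat \<Rightarrow> bool) \<Rightarrow> (nat \<Rightarrow> nat) \<Rightarrow> bool" where
  "feasible nL T g z \<longleftrightarrow> (\<forall>t\<in>{1..T}. z t \<in> {1..nL} \<and> g t (z t))"

definition is_profile_mle ::
    "nat \<Rightarrow> nat \<Rightarrow> nat \<Rightarrow> (nat \<Rightarrow> nat \<Rightarrow> bool) \<Rightarrow> (nat \<Rightarrow> nat) \<Rightarrow> bool" where
  "is_profile_mle nL n T g z \<longleftrightarrow> is_arg_max (profile_loglik n T g) (feasible nL T g) z"

definition mislabeled :: "nat \<Rightarrow> (nat \<Rightarrow> nat) \<Rightarrow> (nat \<Rightarrow> nat) \<Rightarrow> nat" where
  "mislabeled T z z' = card {t \<in> {1..T}. z t \<noteq> z' t}"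

text \<open>
  \<open>X m = o\<^sub>p(1)\<close>; the \<open>X m\<close> may live on different probability spaces.
\<close>

definition small_op_one :: "(nat \<Rightarrow> 'a measure) \<Rightarrow> (nat \<Rightarrow> 'a \<Rightarrow> real) \<Rightarrow> bool" where
  "small_op_one M X \<longleftrightarrow>
     (\<forall>\<epsilon>>0. (\<lambda>m. \<P>(\<omega> in M m. \<bar>X m \<omega>\<bar> > \<epsilon>)) \<longlonglongrightarrow> 0)"

end

theory Submission
  imports Defs
begin

text \<open>
  The estimator is compared with the true parameters through the likelihood, without taking
  logarithms of probabilities that may vanish.  Writing \<open>P t j = A (Z t) j\<close> and
  \<open>Q t j\<close> for the fitted probabilities, the fitted likelihood is at least the true one,
  because the true assignment is feasible almost surely and the frequencies \<open>A_hat\<close> maximize the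
  likelihood of any given assignment.  For a fixed \<open>Q\<close>, this domination has probability at most
  the product of the Hellinger affinities of \<open>P t j\<close> and \<open>Q t j\<close>, hence at most
  \<open>exp (- \<Sum> (P t j - Q t j)\<^sup>2 / 4)\<close>.  A union bound over the assignments and over the
  possible frequency tables forces \<open>\<Sum> (P t j - Q t j)\<^sup>2\<close> to be of order at most
  \<open>T ln nL + nL n ln T\<close>.

  Conversely, feasibility together with the sparsity among leaders allows at most order
  \<open>T / nL\<^sup>2\<close> groups with hub \<open>k\<close> to be assigned to \<open>i \<noteq> k\<close> (a Chernoff bound).  So no wrong
  hub can dominate a cluster unless that cluster is small, and by the separation condition every
  mislabeled group in the other clusters contributes at least \<open>(d / 2)\<^sup>2 v n / nL\<close> to the sum.
\<close>

section \<open>Bernoulli masses and the Hellinger affinity of two of them\<close>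

definition bernoulli_mass :: "real \<Rightarrow> bool \<Rightarrow> real" where
  "bernoulli_mass p b = (if b then p else 1 - p)"

lemma bernoulli_mass_nonneg: "p \<in> {0..1} \<Longrightarrow> 0 \<le> bernoulli_mass p b"
  by (simp add: bernoulli_mass_def)

text \<open>The affinity is one minus half the squared Hellinger distance. Since
  \<open>sqrt x + sqrt y\<close> is at most 2 on the unit interval, each of the two squared
  differences of roots is at least \<open>(p - q)\<^sup>2 / 4\<close>, and
  \<open>1 + u \<le> exp u\<close> finishes. Masses equal to zero are covered.\<close>

lemma hellinger_affinity_le:
  assumes p: "p \<in> {0..1}" and q: "q \<in> {0..1}"
  shows "(\<Sum>b\<in>UNIV. sqrt (bernoulli_mass p b * bernoulli_mass q b)) \<le> exp (- ((p - q)\<^sup>2 / 4))"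
proof -
  have sq: "(x - y)\<^sup>2 / 4 \<le> (sqrt x - sqrt y)\<^sup>2" if "x \<in> {0..1}" "y \<in> {0..1}" for x y :: real
  proof -
    have "(x - y)\<^sup>2 = ((sqrt x - sqrt y) * (sqrt x + sqrt y))\<^sup>2"
      using that by (simp add: algebra_simps)
    also have "\<dots> \<le> (sqrt x - sqrt y)\<^sup>2 * 2\<^sup>2"
      unfolding power_mult_distrib
      using that add_mono[OF real_sqrt_le_mono[of x 1] real_sqrt_le_mono[of y 1]]
      by (intro mult_left_mono power_mono) auto
    finally show ?thesis by simp
  qed
  have "(\<Sum>b\<in>UNIV. sqrt (bernoulli_mass p b * bernoulli_mass q b))
      = 1 - ((sqrt p - sqrt q)\<^sup>2 + (sqrt (1 - p) - sqrt (1 - q))\<^sup>2) / 2"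
    using p q by (simp add: UNIV_bool bernoulli_mass_def real_sqrt_mult power2_diff algebra_simps add_divide_distrib diff_divide_distrib)
  also have "\<dots> \<le> 1 - (p - q)\<^sup>2 / 4"
    using sq[OF p q] sq[of "1 - p" "1 - q"] p q by (simp add: power2_commute)
  also have "\<dots> \<le> exp (- ((p - q)\<^sup>2 / 4))"
    using exp_ge_add_one_self[of "- ((p - q)\<^sup>2 / 4)"] by simp
  finally show ?thesis .
qed

section \<open>Reduction of the joint law of hubs and memberships to finitely many cells\<close>

context asymmetric_hub_model
begin

lemma Z_measurable: "t \<in> {1..T} \<Longrightarrow> Z t \<in> measurable M (count_space UNIV)"
proof -
  assume t: "t \<in> {1..T}"
  have "(\<lambda>\<omega>. (Z t \<omega>, \<lambda>j\<in>{1..n}. G t j \<omega>))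
      \<in> measurable M (count_space UNIV \<Otimes>\<^sub>M (\<Pi>\<^sub>M j\<in>{1..n}. count_space UNIV))"
    using indep_groups t unfolding indep_vars_def by blast
  from measurable_compose[OF this measurable_fst] show ?thesis by simp
qed

lemma G_measurable: "t \<in> {1..T} \<Longrightarrow> j \<in> {1..n} \<Longrightarrow> G t j \<in> measurable M (count_space UNIV)"
proof -
  assume t: "t \<in> {1..T}" and j: "j \<in> {1..n}"
  have "(\<lambda>\<omega>. (Z t \<omega>, \<lambda>j\<in>{1..n}. G t j \<omega>))
      \<in> measurable M (count_space UNIV \<Otimes>\<^sub>M (\<Pi>\<^sub>M j\<in>{1..n}. count_space UNIV))"
    using indep_groups t unfolding indep_vars_def by blast
  from measurable_compose[OF measurable_compose[OF this measurable_snd] measurable_component_singleton[OF j]]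
  show ?thesis using j by simp
qed

lemma n_pos: "1 \<le> nL" "1 \<le> n"
proof -
  show "1 \<le> nL" using rho_sum by (cases "nL = 0") auto
  then show "1 \<le> n" using nL_le_n by simp
qed

lemma group_prob:
  assumes t: "t \<in> {1..T}" and k: "k \<in> {1..nL}"
  shows "prob {\<omega> \<in> space M. Z t \<omega> = k \<and> (\<forall>j\<in>{1..n}. G t j \<omega> = h j)}
    = \<rho> k * (\<Prod>j\<in>{1..n}. bernoulli_mass (A k j) (h j))"
proof -
  note [measurable] = Z_measurable[OF t] G_measurable[OF t]
  let ?B = "{\<omega> \<in> space M. Z t \<omega> = k}"
  have pB: "prob ?B = \<rho> k" using hub_prob[OF t k] .
  show ?thesis
  proof (cases "\<rho> k > 0")
    \<comment> \<open>Nothing is known conditionally on a null hub, but the event lies inside the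
      null event, and both sides vanish.\<close>
    case False
    then have "\<rho> k = 0" using rho_nonneg[OF k] by simp
    moreover have "prob {\<omega> \<in> space M. Z t \<omega> = k \<and> (\<forall>j\<in>{1..n}. G t j \<omega> = h j)} \<le> prob ?B"
      by (intro finite_measure_mono) auto
    ultimately show ?thesis using pB by (simp add: measure_le_0_iff)
  next
    case True
    let ?U = "uniform_measure M ?B"
    have nz: "emeasure M ?B \<noteq> 0" "emeasure M ?B \<noteq> \<infinity>"
      using True pB by (auto simp: emeasure_eq_measure)
    interpret U: prob_space ?U
      using nz by (intro prob_space_uniform_measure) auto
    have mU: "measure ?U {\<omega> \<in> space M. Q \<omega>} = prob {\<omega> \<in> space M. Z t \<omega> = k \<and> Q \<omega>} / \<rho> k"
      if "{\<omega> \<in> space M. Q \<omega>} \<in> sets M" for Q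
    proof -
      have "?B \<inter> {\<omega> \<in> space M. Q \<omega>} = {\<omega> \<in> space M. Z t \<omega> = k \<and> Q \<omega>}" by auto
      then show ?thesis using measure_uniform_measure[OF nz that] pB by simp
    qed
    have single: "measure ?U (G t j -` {h j} \<inter> space ?U) = bernoulli_mass (A k j) (h j)"
      if j: "j \<in> {1..n}" for j
    proof -
      note [measurable] = G_measurable[OF t j]
      have 1: "measure ?U {\<omega> \<in> space M. G t j \<omega>} = A k j"
      proof -
        have "measure ?U {\<omega> \<in> space M. G t j \<omega>} = \<P>(\<omega> in M. G t j \<omega> \<bar> Z t \<omega> = k)"
          using measure_uniform_measure_eq_cond_prob[of "G t j" "\<lambda>\<omega>. Z t \<omega> = k"] by simp
        then show ?thesis using cond_member_prob[OF t k True j] by simp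
      qed
      have 2: "measure ?U {\<omega> \<in> space M. \<not> G t j \<omega>} = 1 - A k j"
      proof -
        have "{\<omega> \<in> space M. \<not> G t j \<omega>} = space ?U - {\<omega> \<in> space M. G t j \<omega>}" by auto
        then show ?thesis using U.prob_compl[of "{\<omega> \<in> space M. G t j \<omega>}"] 1 by simp
      qed
      have "G t j -` {h j} \<inter> space ?U = {\<omega> \<in> space M. if h j then G t j \<omega> else \<not> G t j \<omega>}"
        by auto
      then show ?thesis using 1 2 by (simp add: bernoulli_mass_def)
    qed
    have "U.indep_vars (\<lambda>_. count_space UNIV) (G t) {1..n}" using cond_indep[OF t k True] .
    from U.indep_varsD_finite[OF this, of "\<lambda>j. {h j}"] n_pos
    have "measure ?U (\<Inter>j\<in>{1..n}. G t j -` {h j} \<inter> space ?U)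
        = (\<Prod>j\<in>{1..n}. measure ?U (G t j -` {h j} \<inter> space ?U))" by simp
    also have "\<dots> = (\<Prod>j\<in>{1..n}. bernoulli_mass (A k j) (h j))"
      using single by (intro prod.cong) auto
    also have "(\<Inter>j\<in>{1..n}. G t j -` {h j} \<inter> space ?U) = {\<omega> \<in> space M. \<forall>j\<in>{1..n}. G t j \<omega> = h j}"
      using n_pos by auto
    finally show ?thesis using True by (subst (asm) mU) (auto simp: field_simps)
  qed
qed

text \<open>The joint mass function of hubs and memberships. With it, every event below is bounded
  by a finite sum instead of an integral.\<close>

definition cell_mass :: "(nat \<Rightarrow> nat) \<Rightarrow> (nat \<Rightarrow> nat \<Rightarrow> bool) \<Rightarrow> real" where
  "cell_mass \<zeta> g = (\<Prod>t\<in>{1..T}. \<rho> (\<zeta> t) * (\<Prod>j\<in>{1..n}. bernoulli_mass (A (\<zeta> t) j) (g t j)))"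

definition cell :: "(nat \<Rightarrow> nat) \<Rightarrow> (nat \<Rightarrow> nat \<Rightarrow> bool) \<Rightarrow> 'a set" where
  "cell \<zeta> g = {\<omega> \<in> space M. \<forall>t\<in>{1..T}. Z t \<omega> = \<zeta> t \<and> (\<forall>j\<in>{1..n}. G t j \<omega> = g t j)}"

text \<open>Extensional functions keep this set and the next one finite, as the union bounds
  require.\<close>

definition assignments :: "(nat \<Rightarrow> nat) set" where
  "assignments = {1..T} \<rightarrow>\<^sub>E {1..nL}"

definition observations :: "(nat \<Rightarrow> nat \<Rightarrow> bool) set" where
  "observations = {1..T} \<rightarrow>\<^sub>E ({1..n} \<rightarrow>\<^sub>E UNIV)"

lemma finite_assignments [simp]: "finite assignments"
  and finite_observations [simp]: "finite observations"
  by (auto simp: assignments_def observations_def intro!: finite_PiE)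

lemma cell_sets [measurable]: "cell \<zeta> g \<in> sets M"
  unfolding cell_def using Z_measurable G_measurable by measurable

lemma prob_cell:
  assumes \<zeta>: "\<zeta> \<in> assignments"
  shows "prob (cell \<zeta> g) = cell_mass \<zeta> g"
\<comment> \<open>The product rule for independent variables needs a nonempty index set; without
  groups the cell is the whole space and its mass an empty product.\<close>
proof (cases "T = 0")
  case True
  then show ?thesis unfolding cell_def cell_mass_def by (simp add: prob_space)
next
  case False
  let ?N = "count_space UNIV \<Otimes>\<^sub>M (\<Pi>\<^sub>M j\<in>{1..n}. count_space UNIV)"
  let ?X = "\<lambda>t \<omega>. (Z t \<omega>, \<lambda>j\<in>{1..n}. G t j \<omega>)"
  have in_box: "(\<lambda>j\<in>{1..n}. G t j \<omega>) \<in> (\<Pi>\<^sub>E j\<in>{1..n}. {g t j}) \<longleftrightarrow> (\<forall>j\<in>{1..n}. G t j \<omega> = g t j)"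
    for t \<omega>
    by (auto simp: PiE_iff)
  have "prob (\<Inter>t\<in>{1..T}. ?X t -` ({\<zeta> t} \<times> (\<Pi>\<^sub>E j\<in>{1..n}. {g t j})) \<inter> space M)
      = (\<Prod>t\<in>{1..T}. prob (?X t -` ({\<zeta> t} \<times> (\<Pi>\<^sub>E j\<in>{1..n}. {g t j})) \<inter> space M))"
    using False by (intro indep_varsD_finite[OF indep_groups]) (auto intro!: sets_PiM_I_finite)
  also have "(\<Inter>t\<in>{1..T}. ?X t -` ({\<zeta> t} \<times> (\<Pi>\<^sub>E j\<in>{1..n}. {g t j})) \<inter> space M) = cell \<zeta> g"
  proof (rule set_eqI)
    fix \<omega>
    have "{1..T} \<noteq> {}" using False by simp
    then show "\<omega> \<in> (\<Inter>t\<in>{1..T}. ?X t -` ({\<zeta> t} \<times> (\<Pi>\<^sub>E j\<in>{1..n}. {g t j})) \<inter> space M)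
        \<longleftrightarrow> \<omega> \<in> cell \<zeta> g"
      unfolding cell_def INT_iff vimage_eq Int_iff mem_Sigma_iff singleton_iff in_box mem_Collect_eq by blast
  qed
  also have "(\<Prod>t\<in>{1..T}. prob (?X t -` ({\<zeta> t} \<times> (\<Pi>\<^sub>E j\<in>{1..n}. {g t j})) \<inter> space M)) = cell_mass \<zeta> g"
    unfolding cell_mass_def
  proof (intro prod.cong refl)
    fix t assume t: "t \<in> {1..T}"
    have "?X t -` ({\<zeta> t} \<times> (\<Pi>\<^sub>E j\<in>{1..n}. {g t j})) \<inter> space M
        = {\<omega> \<in> space M. Z t \<omega> = \<zeta> t \<and> (\<forall>j\<in>{1..n}. G t j \<omega> = g t j)}"
      by (rule set_eqI) (unfold vimage_eq Int_iff mem_Sigma_iff singleton_iff in_box mem_Collect_eq, blast)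
    moreover have "\<zeta> t \<in> {1..nL}" using \<zeta> t by (auto simp: assignments_def)
    ultimately show "prob (?X t -` ({\<zeta> t} \<times> (\<Pi>\<^sub>E j\<in>{1..n}. {g t j})) \<inter> space M)
        = \<rho> (\<zeta> t) * (\<Prod>j\<in>{1..n}. bernoulli_mass (A (\<zeta> t) j) (g t j))"
      using group_prob[OF t] by simp
  qed
  finally show ?thesis .
qed

lemma cell_mass_nonneg: "\<zeta> \<in> assignments \<Longrightarrow> 0 \<le> cell_mass \<zeta> g"
  by (metis prob_cell measure_nonneg)

text \<open>The model only fixes the probabilities of the values in \<open>{1..nL}\<close>; they add
  up to one, so all other values together form a null event.\<close>

lemma AE_Z_range: "AE \<omega> in M. \<forall>t\<in>{1..T}. Z t \<omega> \<in> {1..nL}"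
proof (rule AE_finite_allI)
  fix t assume t: "t \<in> {1..T}"
  note [measurable] = Z_measurable[OF t]
  have "prob {\<omega> \<in> space M. Z t \<omega> \<in> {1..nL}} = prob (\<Union>i\<in>{1..nL}. {\<omega> \<in> space M. Z t \<omega> = i})"
    by (intro arg_cong[where f=prob]) auto
  also have "\<dots> = (\<Sum>i\<in>{1..nL}. prob {\<omega> \<in> space M. Z t \<omega> = i})"
    by (intro finite_measure_finite_Union) (auto simp: disjoint_family_on_def)
  also have "\<dots> = 1" using hub_prob[OF t] rho_sum by simp
  finally show "AE \<omega> in M. Z t \<omega> \<in> {1..nL}" by (subst (asm) prob_Collect_eq_1) auto
qed simp

text \<open>The transfer from the probability space to the mass function: a union bound over the
  cells, whose masses are their probabilities.\<close>

lemma prob_le_sum_cell_mass: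
  assumes imp: "AE \<omega> in M. \<omega> \<in> E \<longrightarrow>
    (\<exists>(\<zeta>, g) \<in> K. \<omega> \<in> cell \<zeta> g)" and K: "K \<subseteq> assignments \<times> observations"
  shows "prob E \<le> (\<Sum>(\<zeta>, g)\<in>K. cell_mass \<zeta> g)"
proof -
  have fin: "finite K" using K by (rule finite_subset) simp
  have "prob E \<le> prob (\<Union>c\<in>K. cell (fst c) (snd c))"
    using fin imp by (intro finite_measure_mono_AE) (force elim!: eventually_mono)+
  also have "\<dots> \<le> (\<Sum>c\<in>K. prob (cell (fst c) (snd c)))"
    using fin by (intro finite_measure_subadditive_finite) auto
  also have "\<dots> = (\<Sum>(\<zeta>, g)\<in>K. cell_mass \<zeta> g)"
    using K by (intro sum.cong) (auto simp: prob_cell)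
  finally show ?thesis .
qed

text \<open>Finitely many cells of mass zero are discarded. Positivity is what later makes the true
  assignment feasible, because a hub missing from its own group would contribute a zero
  factor.\<close>

lemma AE_cell_mass_pos:
  "AE \<omega> in M. \<exists>\<zeta>\<in>assignments. \<exists>g\<in>observations. \<omega> \<in> cell \<zeta> g \<and> 0 < cell_mass \<zeta> g"
proof -
  let ?K = "{(\<zeta>, g) \<in> assignments \<times> observations. cell_mass \<zeta> g = 0}"
  have fin: "finite ?K" by (rule finite_subset[of _ "assignments \<times> observations"]) auto
  have "AE \<omega> in M. \<forall>c\<in>?K. \<omega> \<notin> cell (fst c) (snd c)"
  proof (rule AE_finite_allI[OF fin])
    fix c assume "c \<in> ?K"
    then show "AE \<omega> in M. \<omega> \<notin> cell (fst c) (snd c)"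
      by (intro AE_not_in) (auto simp: null_sets_def emeasure_eq_measure prob_cell)
  qed
  then show ?thesis using AE_Z_range AE_space
  proof eventually_elim
    case (elim \<omega>)
    let ?\<zeta> = "\<lambda>t\<in>{1..T}. Z t \<omega>" and ?g = "\<lambda>t\<in>{1..T}. \<lambda>j\<in>{1..n}. G t j \<omega>"
    have "?\<zeta> \<in> assignments" "?g \<in> observations" "\<omega> \<in> cell ?\<zeta> ?g"
      using elim by (auto simp: assignments_def observations_def cell_def)
    moreover from this elim(1) have "cell_mass ?\<zeta> ?g \<noteq> 0" by fastforce
    ultimately show ?case using cell_mass_nonneg[of ?\<zeta> ?g] by (metis less_le)
  qed
qed

end

section \<open>Union bounds for the two exceptional events\<close>

lemma sum_UN_le:
  fixes f :: "'b \<Rightarrow> real"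
  assumes "finite I" and "\<And>i. i \<in> I \<Longrightarrow> finite (S i)" and "\<And>i x. i \<in> I \<Longrightarrow> x \<in> S i \<Longrightarrow> 0 \<le> f x"
  shows "sum f (\<Union>i\<in>I. S i) \<le> (\<Sum>i\<in>I. sum f (S i))"
  using assms
proof (induction I)
  case (insert i I)
  have "sum f (S i \<union> (\<Union>i\<in>I. S i)) \<le> sum f (S i) + sum f (\<Union>i\<in>I. S i)"
    using insert by (subst sum_Un) (auto intro!: sum_nonneg)
  also have "\<dots> \<le> sum f (S i) + (\<Sum>i\<in>I. sum f (S i))"
    using insert by (intro add_left_mono insert.IH) auto
  finally show ?case using insert by simp
qed simp

lemma sqrt_prod: "finite I \<Longrightarrow> sqrt (prod f I) = (\<Prod>i\<in>I. sqrt (f i))"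
  by (induction I rule: finite_induct) (auto simp: real_sqrt_mult)

text \<open>The pairs with \<open>b = 0\<close> cover the entry \<open>0\<close> that \<open>A_hat\<close> has for an empty cluster.\<close>

definition frequencies :: "nat \<Rightarrow> real set" where
  "frequencies T = {0..1} \<inter> (\<lambda>(a, b). real a / real b) ` ({..T} \<times> {..T})"

lemma finite_frequencies [simp]: "finite (frequencies T)"
  by (simp add: frequencies_def)

lemma card_frequencies_le: "card (frequencies T) \<le> (T + 1)\<^sup>2"
proof -
  have "card (frequencies T) \<le> card ((\<lambda>(a, b). real a / real b) ` ({..T} \<times> {..T}))"
    unfolding frequencies_def by (intro card_mono) auto
  also have "\<dots> \<le> card ({..T} \<times> {..T})" by (intro card_image_le) auto
  finally show ?thesis by (simp add: power2_eq_square)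
qed

context asymmetric_hub_model
begin

text \<open>Independence in the form of finite sums: by distributivity, a product weight summed over
  all membership tables factorizes entry by entry.\<close>

lemma sum_observations:
  fixes c :: "nat \<Rightarrow> real"
  shows "(\<Sum>g\<in>observations. \<Prod>t\<in>{1..T}. c t * (\<Prod>j\<in>{1..n}. w t j (g t j)))
    = (\<Prod>t\<in>{1..T}. c t * (\<Prod>j\<in>{1..n}. \<Sum>b\<in>UNIV. w t j b))"
  unfolding observations_def
  by (subst prod_sum_PiE[symmetric]) (auto simp: prod_sum_PiE sum_distrib_left intro!: finite_PiE)

lemma sum_assignments:
  fixes \<psi> :: "nat \<Rightarrow> real"
  shows "(\<Sum>\<zeta>\<in>assignments. \<Prod>t\<in>{1..T}. \<psi> (\<zeta> t)) = (\<Sum>k\<in>{1..nL}. \<psi> k) ^ T"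
  unfolding assignments_def by (subst prod_sum_PiE[symmetric]) auto

text \<open>The exponential moment, at exponent one, of the number of groups with hub
  \<open>k\<close> that contain \<open>i\<close>. The tilted weights still factorize, each group
  contributes \<open>1 + (exp 1 - 1) * (\<rho> k * A k i)\<close>, and
  \<open>exp 1 - 1 \<le> 2\<close>.\<close>

lemma exponential_moment_le:
  assumes k: "k \<in> {1..nL}" and i: "i \<in> {1..nL}"
  shows "(\<Sum>\<zeta>\<in>assignments. \<Sum>g\<in>observations.
      cell_mass \<zeta> g * exp (real (card {t \<in> {1..T}. \<zeta> t = k \<and> g t i})))
    \<le> exp (2 * (real T * (\<rho> k * A k i)))"
proof -
  have i': "i \<in> {1..n}" using i nL_le_n by auto
  \<comment> \<open>The factor \<open>exp 1\<close> of a counted group is placed on the entry of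
    node \<open>i\<close>, which keeps the weight a product over entries. There the two tilted
    masses sum to \<open>exp 1 * A k i + (1 - A k i)\<close>; for any other node or hub they sum to
    one.\<close>
  let ?w = "\<lambda>\<kappa> j b. bernoulli_mass (A \<kappa> j) b * (if j = i \<and> \<kappa> = k \<and> b then exp 1 else 1)"
  let ?\<psi> = "\<lambda>\<kappa>. \<rho> \<kappa> * (if \<kappa> = k then 1 + (exp 1 - 1) * A k i else 1)"
  have w: "(\<Prod>j\<in>{1..n}. \<Sum>b\<in>UNIV. ?w \<kappa> j b) = (if \<kappa> = k then 1 + (exp 1 - 1) * A k i else 1)" for \<kappa>
  proof -
    have "(\<Prod>j\<in>{1..n}. \<Sum>b\<in>UNIV. ?w \<kappa> j b)
        = (\<Prod>j\<in>{1..n}. if j = i then (if \<kappa> = k then 1 + (exp 1 - 1) * A k i else 1) else 1)"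
      by (intro prod.cong refl) (auto simp: UNIV_bool bernoulli_mass_def algebra_simps)
    then show ?thesis using i' by (simp add: prod.delta)
  qed
  have tilt: "cell_mass \<zeta> g * exp (real (card {t \<in> {1..T}. \<zeta> t = k \<and> g t i}))
      = (\<Prod>t\<in>{1..T}. \<rho> (\<zeta> t) * (\<Prod>j\<in>{1..n}. ?w (\<zeta> t) j (g t j)))" for \<zeta> g
  proof -
    have "exp (real (card {t \<in> {1..T}. \<zeta> t = k \<and> g t i}))
        = (\<Prod>t\<in>{1..T}. if \<zeta> t = k \<and> g t i then exp 1 else 1)"
      by (simp add: prod.If_cases exp_of_nat_mult[symmetric] Int_def flip: power_one_right)
    also have "\<dots> = (\<Prod>t\<in>{1..T}. \<Prod>j\<in>{1..n}. if j = i \<and> \<zeta> t = k \<and> g t j then exp 1 else 1)"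
    proof (intro prod.cong refl)
      fix t
      have "(\<Prod>j\<in>{1..n}. if j = i \<and> \<zeta> t = k \<and> g t j then exp 1 else (1::real))
          = (\<Prod>j\<in>{1..n}. if j = i then (if \<zeta> t = k \<and> g t i then exp 1 else 1) else 1)"
        by (intro prod.cong) auto
      then show "(if \<zeta> t = k \<and> g t i then exp 1 else 1)
          = (\<Prod>j\<in>{1..n}. if j = i \<and> \<zeta> t = k \<and> g t j then exp 1 else (1::real))"
        using i' by (simp add: prod.delta)
    qed
    finally show ?thesis
      by (simp only: cell_mass_def prod.distrib[symmetric] mult.assoc)
  qed
  have "(\<Sum>\<zeta>\<in>assignments. \<Sum>g\<in>observations.
      cell_mass \<zeta> g * exp (real (card {t \<in> {1..T}. \<zeta> t = k \<and> g t i})))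
      = (\<Sum>\<zeta>\<in>assignments. \<Prod>t\<in>{1..T}. ?\<psi> (\<zeta> t))"
  proof (rule sum.cong[OF refl])
    fix \<zeta>
    show "(\<Sum>g\<in>observations. cell_mass \<zeta> g * exp (real (card {t \<in> {1..T}. \<zeta> t = k \<and> g t i})))
        = (\<Prod>t\<in>{1..T}. ?\<psi> (\<zeta> t))"
      using sum_observations[of "\<lambda>t. \<rho> (\<zeta> t)" "\<lambda>t. ?w (\<zeta> t)"] by (simp only: tilt w)
  qed
  also have "\<dots> = (\<Sum>\<kappa>\<in>{1..nL}. ?\<psi> \<kappa>) ^ T" by (rule sum_assignments)
  also have "(\<Sum>\<kappa>\<in>{1..nL}. ?\<psi> \<kappa>) = (\<Sum>\<kappa>\<in>{1..nL}. \<rho> \<kappa> + (if \<kappa> = k then (exp 1 - 1) * (\<rho> k * A k i) else 0))"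
    by (intro sum.cong) (auto simp: algebra_simps)
  also have "\<dots> = 1 + (exp 1 - 1) * (\<rho> k * A k i)"
    using k rho_sum by (simp add: sum.distrib sum.delta)
  also have "\<dots> ^ T \<le> exp (2 * (\<rho> k * A k i)) ^ T"
  proof (intro power_mono)
    have "0 \<le> \<rho> k * A k i" using rho_nonneg[OF k] A_range[OF k i'] by simp
    then have "(exp 1 - 1) * (\<rho> k * A k i) \<le> 2 * (\<rho> k * A k i)" "0 \<le> (exp 1 - 1) * (\<rho> k * A k i)"
      using exp_le by (auto intro!: mult_right_mono mult_nonneg_nonneg)
    then show "1 + (exp 1 - 1) * (\<rho> k * A k i) \<le> exp (2 * (\<rho> k * A k i))" "0 \<le> 1 + (exp 1 - 1) * (\<rho> k * A k i)"
      using exp_ge_add_one_self[of "2 * (\<rho> k * A k i)"] by linarith+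
  qed
  finally show ?thesis by (simp add: exp_of_nat_mult[symmetric] mult_ac)
qed

text \<open>The event does not mention the estimator. A feasible assignment can send a group with
  hub \<open>k\<close> to \<open>i\<close> only if \<open>i\<close> belongs to that group, so these
  counts bound the confusion of \<open>k\<close> with \<open>i\<close> for all feasible assignments
  at once.\<close>

definition wrong_leader_event :: "real \<Rightarrow> ((nat \<Rightarrow> nat) \<times> (nat \<Rightarrow> nat \<Rightarrow> bool)) set" where
  "wrong_leader_event S = {(\<zeta>, g) \<in> assignments \<times> observations.
     \<exists>k\<in>{1..nL}. \<exists>i\<in>{1..nL}. k \<noteq> i \<and> S \<le> real (card {t \<in> {1..T}. \<zeta> t = k \<and> g t i})}"

text \<open>Chernoff bound: on the event for a pair, the mass may be multiplied by
  \<open>exp (count - S)\<close>, which is at least one, and the sum extended to everything. The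
  factor \<open>(real nL)\<^sup>2\<close> bounds the number of ordered pairs.\<close>

lemma wrong_leader_event_mass:
  assumes a: "\<And>k i. k \<in> {1..nL} \<Longrightarrow> i \<in> {1..nL} \<Longrightarrow> k \<noteq> i \<Longrightarrow> \<rho> k * A k i \<le> a"
  shows "(\<Sum>(\<zeta>, g)\<in>wrong_leader_event S. cell_mass \<zeta> g) \<le> (real nL)\<^sup>2 * exp (2 * (real T * a) - S)"
proof -
  let ?E = "\<lambda>(k, i). {(\<zeta>, g) \<in> assignments \<times> observations.
     S \<le> real (card {t \<in> {1..T}. \<zeta> t = k \<and> g t i})}"
  let ?I = "{(k, i) \<in> {1..nL} \<times> {1..nL}. k \<noteq> i}"
  have finI: "finite ?I" by (rule finite_subset[of _ "{1..nL} \<times> {1..nL}"]) auto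
  have finE: "finite (?E c)" for c
    by (rule finite_subset[of _ "assignments \<times> observations"]) auto
  have mass: "(\<Sum>(\<zeta>, g)\<in>?E c. cell_mass \<zeta> g) \<le> exp (2 * (real T * a) - S)" if c: "c \<in> ?I" for c
  proof -
    obtain k i where [simp]: "c = (k, i)" and ki: "k \<in> {1..nL}" "i \<in> {1..nL}" "k \<noteq> i" using c by auto
    let ?N = "\<lambda>\<zeta> g. real (card {t \<in> {1..T}. \<zeta> t = k \<and> g t i})"
    have "(\<Sum>(\<zeta>, g)\<in>?E c. cell_mass \<zeta> g) \<le> (\<Sum>(\<zeta>, g)\<in>?E c. cell_mass \<zeta> g * exp (?N \<zeta> g - S))"
    proof (intro sum_mono, clarsimp)
      fix \<zeta> g assume "\<zeta> \<in> assignments" and S: "S \<le> real (card {t. Suc 0 \<le> t \<and> t \<le> T \<and> \<zeta> t = k \<and> g t i})"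
      then show "cell_mass \<zeta> g \<le> cell_mass \<zeta> g * exp (real (card {t. Suc 0 \<le> t \<and> t \<le> T \<and> \<zeta> t = k \<and> g t i}) - S)"
        using mult_left_mono[of 1 "exp (real (card {t. Suc 0 \<le> t \<and> t \<le> T \<and> \<zeta> t = k \<and> g t i}) - S)" "cell_mass \<zeta> g"]
          cell_mass_nonneg by simp
    qed
    also have "\<dots> \<le> (\<Sum>(\<zeta>, g)\<in>assignments \<times> observations. cell_mass \<zeta> g * exp (?N \<zeta> g - S))"
      by (intro sum_mono2) (auto intro!: cell_mass_nonneg mult_nonneg_nonneg)
    also have "\<dots> = (\<Sum>\<zeta>\<in>assignments. \<Sum>g\<in>observations. cell_mass \<zeta> g * exp (?N \<zeta> g)) * exp (- S)"
      by (simp add: sum.cartesian_product[symmetric] sum_distrib_right mult.assoc flip: exp_add)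
    also have "\<dots> \<le> exp (2 * (real T * (\<rho> k * A k i))) * exp (- S)"
      using exponential_moment_le[OF ki(1,2)] by (intro mult_right_mono) auto
    also have "\<dots> \<le> exp (2 * (real T * a) - S)"
      using a[OF ki] by (simp add: exp_add[symmetric] mult_left_mono)
    finally show ?thesis .
  qed
  have "(\<Sum>(\<zeta>, g)\<in>wrong_leader_event S. cell_mass \<zeta> g) = (\<Sum>(\<zeta>, g)\<in>(\<Union>c\<in>?I. ?E c). cell_mass \<zeta> g)"
    by (intro sum.cong) (auto simp: wrong_leader_event_def simp del: atLeastAtMost_iff)
  also have "\<dots> \<le> (\<Sum>c\<in>?I. \<Sum>(\<zeta>, g)\<in>?E c. cell_mass \<zeta> g)"
    using finI finE by (intro sum_UN_le) (auto intro!: cell_mass_nonneg)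
  also have "\<dots> \<le> (\<Sum>c\<in>?I. exp (2 * (real T * a) - S))" using mass by (rule sum_mono)
  also have "\<dots> = real (card ?I) * exp (2 * (real T * a) - S)" by simp
  also have "\<dots> \<le> (real nL)\<^sup>2 * exp (2 * (real T * a) - S)"
  proof (rule mult_right_mono)
    have "card ?I \<le> card ({1..nL} \<times> {1..nL})" by (rule card_mono) auto
    then have "card ?I \<le> nL\<^sup>2" by (simp add: power2_eq_square)
    then show "real (card ?I) \<le> (real nL)\<^sup>2" using of_nat_mono[of "card ?I" "nL\<^sup>2", where 'a=real] by simp
  qed simp
  finally show ?thesis .
qed

lemma prod_rho_nonneg: "\<zeta> \<in> assignments \<Longrightarrow> 0 \<le> (\<Prod>t\<in>{1..T}. \<rho> (\<zeta> t))"
  unfolding assignments_def by (intro prod_nonneg ballI rho_nonneg) (rule PiE_mem)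

text \<open>Where one likelihood is at most the other, it is at most the geometric mean of both.
  Summed over all tables, the geometric mean factorizes into Hellinger affinities, each bounded by
  an exponential.\<close>

lemma likelihood_ratio_mass:
  assumes \<zeta>: "\<zeta> \<in> assignments"
    and Q: "\<And>t j. t \<in> {1..T} \<Longrightarrow> j \<in> {1..n} \<Longrightarrow> Q t j \<in> {0..1}"
  shows "(\<Sum>g | g \<in> observations \<and>
        (\<Prod>t\<in>{1..T}. \<Prod>j\<in>{1..n}. bernoulli_mass (A (\<zeta> t) j) (g t j))
        \<le> (\<Prod>t\<in>{1..T}. \<Prod>j\<in>{1..n}. bernoulli_mass (Q t j) (g t j)). cell_mass \<zeta> g)
    \<le> (\<Prod>t\<in>{1..T}. \<rho> (\<zeta> t)) * exp (- ((\<Sum>t\<in>{1..T}. \<Sum>j\<in>{1..n}. (A (\<zeta> t) j - Q t j)\<^sup>2) / 4))"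
proof -
  let ?P = "\<lambda>g. \<Prod>t\<in>{1..T}. \<Prod>j\<in>{1..n}. bernoulli_mass (A (\<zeta> t) j) (g t j)"
  let ?Q = "\<lambda>g. \<Prod>t\<in>{1..T}. \<Prod>j\<in>{1..n}. bernoulli_mass (Q t j) (g t j)"
  let ?s = "\<lambda>t j b. sqrt (bernoulli_mass (A (\<zeta> t) j) b * bernoulli_mass (Q t j) b)"
  have \<zeta>_range: "\<zeta> t \<in> {1..nL}" if "t \<in> {1..T}" for t using \<zeta> that by (auto simp: assignments_def)
  have A01: "A (\<zeta> t) j \<in> {0..1}" if "t \<in> {1..T}" "j \<in> {1..n}" for t j
    using A_range \<zeta>_range that by blast
  have \<rho>0: "0 \<le> (\<Prod>t\<in>{1..T}. \<rho> (\<zeta> t))" using prod_rho_nonneg[OF \<zeta>] .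
  have P0: "0 \<le> ?P g" and Q0: "0 \<le> ?Q g" for g
    using A01 Q by (intro prod_nonneg ballI bernoulli_mass_nonneg; blast)+
  have "(\<Sum>g | g \<in> observations \<and> ?P g \<le> ?Q g. cell_mass \<zeta> g)
      \<le> (\<Sum>g | g \<in> observations \<and> ?P g \<le> ?Q g. (\<Prod>t\<in>{1..T}. \<rho> (\<zeta> t)) * sqrt (?P g * ?Q g))"
  proof (intro sum_mono)
    fix g assume "g \<in> {g. g \<in> observations \<and> ?P g \<le> ?Q g}"
    then have "?P g * ?P g \<le> ?P g * ?Q g" using P0[of g] by (intro mult_left_mono) auto
    then have "?P g \<le> sqrt (?P g * ?Q g)" by (intro real_le_rsqrt) (simp only: power2_eq_square)
    then show "cell_mass \<zeta> g \<le> (\<Prod>t\<in>{1..T}. \<rho> (\<zeta> t)) * sqrt (?P g * ?Q g)"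
      using \<rho>0 by (simp add: cell_mass_def prod.distrib mult_left_mono)
  qed
  also have "\<dots> \<le> (\<Sum>g\<in>observations. (\<Prod>t\<in>{1..T}. \<rho> (\<zeta> t)) * sqrt (?P g * ?Q g))"
    using \<rho>0 P0 Q0 by (intro sum_mono2) auto
  also have "\<dots> = (\<Sum>g\<in>observations. \<Prod>t\<in>{1..T}. \<rho> (\<zeta> t) * (\<Prod>j\<in>{1..n}. ?s t j (g t j)))"
    by (simp add: prod.distrib[symmetric] sqrt_prod)
  also have "\<dots> = (\<Prod>t\<in>{1..T}. \<rho> (\<zeta> t) * (\<Prod>j\<in>{1..n}. \<Sum>b\<in>UNIV. ?s t j b))"
    by (rule sum_observations)
  also have "\<dots> = (\<Prod>t\<in>{1..T}. \<rho> (\<zeta> t)) * (\<Prod>t\<in>{1..T}. \<Prod>j\<in>{1..n}. \<Sum>b\<in>UNIV. ?s t j b)"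
    by (rule prod.distrib)
  also have "(\<Prod>t\<in>{1..T}. \<Prod>j\<in>{1..n}. \<Sum>b\<in>UNIV. ?s t j b)
      \<le> (\<Prod>t\<in>{1..T}. \<Prod>j\<in>{1..n}. exp (- ((A (\<zeta> t) j - Q t j)\<^sup>2 / 4)))"
    using A01 Q by (intro prod_mono conjI hellinger_affinity_le prod_nonneg sum_nonneg
        ballI real_sqrt_ge_zero mult_nonneg_nonneg bernoulli_mass_nonneg)
  also have "(\<Prod>t\<in>{1..T}. \<Prod>j\<in>{1..n}. exp (- ((A (\<zeta> t) j - Q t j)\<^sup>2 / 4)))
      = exp (- ((\<Sum>t\<in>{1..T}. \<Sum>j\<in>{1..n}. (A (\<zeta> t) j - Q t j)\<^sup>2) / 4))"
    by (simp add: exp_sum[symmetric] sum_negf sum_divide_distrib)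
  finally show ?thesis using \<rho>0 by (simp add: mult_left_mono)
qed

text \<open>The fitted probabilities depend on the data, so all candidates are listed: an assignment
  together with a table of possible frequencies. The threshold \<open>4 * x\<close> cancels the
  division by 4 in the affinity exponent.\<close>

definition misfit_event :: "real \<Rightarrow> ((nat \<Rightarrow> nat) \<times> (nat \<Rightarrow> nat \<Rightarrow> bool)) set" where
  "misfit_event x = {(\<zeta>, g) \<in> assignments \<times> observations.
     \<exists>z\<in>assignments. \<exists>B\<in>{1..nL} \<rightarrow>\<^sub>E ({1..n} \<rightarrow>\<^sub>E frequencies T).
       (\<Prod>t\<in>{1..T}. \<Prod>j\<in>{1..n}. bernoulli_mass (A (\<zeta> t) j) (g t j))
       \<le> (\<Prod>t\<in>{1..T}. \<Prod>j\<in>{1..n}. bernoulli_mass (B (z t) j) (g t j)) \<and>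
       4 * x \<le> (\<Sum>t\<in>{1..T}. \<Sum>j\<in>{1..n}. (A (\<zeta> t) j - B (z t) j)\<^sup>2)}"

text \<open>For a fixed candidate \<open>(z, B)\<close> the likelihood comparison is made separately
  for each hub vector; the hub weights then sum to one, so the candidate costs
  \<open>exp (- x)\<close>. The two powers count the assignments and bound the number of frequency
  tables.\<close>

lemma misfit_event_mass:
  "(\<Sum>(\<zeta>, g)\<in>misfit_event x. cell_mass \<zeta> g)
    \<le> real nL ^ T * real (T + 1) ^ (2 * (nL * n)) * exp (- x)"
proof -
  let ?B = "{1..nL} \<rightarrow>\<^sub>E ({1..n} \<rightarrow>\<^sub>E frequencies T)"
  let ?I = "assignments \<times> ?B"
  let ?P = "\<lambda>\<zeta> g. \<Prod>t\<in>{1..T}. \<Prod>j\<in>{1..n}. bernoulli_mass (A (\<zeta> t) j) (g t j)"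
  let ?Q = "\<lambda>z B g. \<Prod>t\<in>{1..T}. \<Prod>j\<in>{1..n}. bernoulli_mass (B (z t) j) (g t j)"
  let ?D = "\<lambda>\<zeta> z B. \<Sum>t\<in>{1..T}. \<Sum>j\<in>{1..n}. (A (\<zeta> t) j - B (z t) j)\<^sup>2"
  let ?E = "\<lambda>(z, B). SIGMA \<zeta>:{\<zeta> \<in> assignments. 4 * x \<le> ?D \<zeta> z B}. {g \<in> observations. ?P \<zeta> g \<le> ?Q z B g}"
  have finB: "finite ?B" by (intro finite_PiE) auto
  have finE: "finite (?E c)" for c by (cases c) auto
  have mass: "(\<Sum>(\<zeta>, g)\<in>?E c. cell_mass \<zeta> g) \<le> exp (- x)" if c: "c \<in> ?I" for c
  proof -
    obtain z B where [simp]: "c = (z, B)" and z: "z \<in> assignments" and B: "B \<in> ?B" using c by auto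
    have B01: "B (z t) j \<in> {0..1}" if "t \<in> {1..T}" "j \<in> {1..n}" for t j
    proof -
      have "z t \<in> {1..nL}" using z that by (auto simp: assignments_def)
      then have "B (z t) j \<in> frequencies T" using B that by (meson PiE_mem)
      then show ?thesis by (simp add: frequencies_def)
    qed
    have "(\<Sum>(\<zeta>, g)\<in>?E c. cell_mass \<zeta> g)
        = (\<Sum>\<zeta> | \<zeta> \<in> assignments \<and> 4 * x \<le> ?D \<zeta> z B. \<Sum>g | g \<in> observations \<and> ?P \<zeta> g \<le> ?Q z B g. cell_mass \<zeta> g)"
      by (simp add: sum.Sigma)
    also have "\<dots> \<le> (\<Sum>\<zeta> | \<zeta> \<in> assignments \<and> 4 * x \<le> ?D \<zeta> z B. (\<Prod>t\<in>{1..T}. \<rho> (\<zeta> t)) * exp (- x))"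
    proof (rule sum_mono)
      fix \<zeta> assume "\<zeta> \<in> {\<zeta>. \<zeta> \<in> assignments \<and> 4 * x \<le> ?D \<zeta> z B}"
      then have \<zeta>: "\<zeta> \<in> assignments" and x: "4 * x \<le> ?D \<zeta> z B" by auto
      have "(\<Sum>g | g \<in> observations \<and> ?P \<zeta> g \<le> ?Q z B g. cell_mass \<zeta> g)
          \<le> (\<Prod>t\<in>{1..T}. \<rho> (\<zeta> t)) * exp (- (?D \<zeta> z B / 4))"
        using B01 by (intro likelihood_ratio_mass \<zeta>) auto
      also have "\<dots> \<le> (\<Prod>t\<in>{1..T}. \<rho> (\<zeta> t)) * exp (- x)"
        using x prod_rho_nonneg[OF \<zeta>] by (intro mult_left_mono) auto
      finally show "(\<Sum>g | g \<in> observations \<and> ?P \<zeta> g \<le> ?Q z B g. cell_mass \<zeta> g)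
          \<le> (\<Prod>t\<in>{1..T}. \<rho> (\<zeta> t)) * exp (- x)" .
    qed
    also have "\<dots> \<le> (\<Sum>\<zeta>\<in>assignments. (\<Prod>t\<in>{1..T}. \<rho> (\<zeta> t)) * exp (- x))"
      using prod_rho_nonneg by (intro sum_mono2) auto
    also have "\<dots> = exp (- x)"
      using sum_assignments[of \<rho>] rho_sum by (simp add: sum_distrib_right[symmetric])
    finally show ?thesis .
  qed
  have "(\<Sum>(\<zeta>, g)\<in>misfit_event x. cell_mass \<zeta> g) = (\<Sum>(\<zeta>, g)\<in>(\<Union>c\<in>?I. ?E c). cell_mass \<zeta> g)"
    by (intro sum.cong) (auto simp: misfit_event_def)
  also have "\<dots> \<le> (\<Sum>c\<in>?I. \<Sum>(\<zeta>, g)\<in>?E c. cell_mass \<zeta> g)"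
    using finB finE by (intro sum_UN_le) (auto intro!: cell_mass_nonneg)
  also have "\<dots> \<le> (\<Sum>c\<in>?I. exp (- x))" using mass by (rule sum_mono)
  also have "\<dots> = real (card ?I) * exp (- x)" by simp
  also have "\<dots> \<le> real nL ^ T * real (T + 1) ^ (2 * (nL * n)) * exp (- x)"
  proof (rule mult_right_mono)
    have "card ?I = nL ^ T * (card (frequencies T) ^ n) ^ nL"
      by (simp add: card_cartesian_product assignments_def card_funcsetE)
    also have "\<dots> \<le> nL ^ T * (((T + 1)\<^sup>2) ^ n) ^ nL"
      by (intro mult_left_mono power_mono card_frequencies_le) auto
    also have "\<dots> = nL ^ T * (T + 1) ^ (2 * (nL * n))"
      by (simp only: power_mult[symmetric] mult_ac)
    finally show "real (card ?I) \<le> real nL ^ T * real (T + 1) ^ (2 * (nL * n))"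
      using of_nat_mono[of "card ?I" "nL ^ T * (T + 1) ^ (2 * (nL * n))", where 'a=real] by simp
  qed simp
  finally show ?thesis .
qed

end

section \<open>Maximality of the empirical frequencies in the profile likelihood\<close>

lemma A_hat_eq:
  "A_hat T g z i j = real (card {t \<in> {1..T}. z t = i \<and> g t j}) / real (card {t \<in> {1..T}. z t = i})"
proof -
  have "(\<Sum>t\<in>{1..T}. of_bool (g t j) * of_bool (z t = i)) = (\<Sum>t\<in>{1..T}. of_bool (z t = i \<and> g t j) :: real)"
    by (intro sum.cong) auto
  then show ?thesis by (simp add: A_hat_def group_count_def Int_def conj_ac)
qed

lemma A_hat_frequencies: "A_hat T g z i j \<in> frequencies T"
proof -
  let ?k = "card {t \<in> {1..T}. z t = i \<and> g t j}" and ?m = "card {t \<in> {1..T}. z t = i}"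
  have "?m \<le> card {1..T}" by (intro card_mono) auto
  then have m: "?m \<le> T" by simp
  have km: "?k \<le> ?m" by (rule card_mono) auto
  have "real a / real b \<in> {0..1}" if "a \<le> b" for a b :: nat
    using that by (cases "b = 0") (auto simp: divide_le_eq_1)
  from this[OF km] show ?thesis
    using m km unfolding frequencies_def A_hat_eq by (auto intro!: image_eqI[of _ _ "(?k, ?m)"])
qed

text \<open>Group \<open>t\<close> lies in its own cluster, so the value it takes at
  \<open>j\<close> has positive frequency there. This makes the logarithms genuine and allows
  likelihood ratios with this denominator.\<close>

lemma bernoulli_mass_A_hat_pos:
  assumes t: "t \<in> {1..T}"
  shows "0 < bernoulli_mass (A_hat T g z (z t) j) (g t j)"
proof -
  let ?K = "{s \<in> {1..T}. z s = z t \<and> g s j}" and ?C = "{s \<in> {1..T}. z s = z t}"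
  have C: "0 < card ?C" using t by (auto simp: card_gt_0_iff)
  show ?thesis
  proof (cases "g t j")
    case True
    then have "0 < card ?K" using t by (auto simp: card_gt_0_iff)
    then show ?thesis using True C by (simp add: bernoulli_mass_def A_hat_eq)
  next
    case False
    then have "?K \<subset> ?C" using t by auto
    then have "card ?K < card ?C" by (intro psubset_card_mono) auto
    then show ?thesis using False C by (simp add: bernoulli_mass_def A_hat_eq)
  qed
qed

text \<open>In product form the fitted likelihood can be compared with likelihoods that may
  vanish.\<close>

lemma exp_profile_loglik:
  "exp (profile_loglik n T g z)
    = (\<Prod>t\<in>{1..T}. \<Prod>j\<in>{1..n}. bernoulli_mass (A_hat T g z (z t) j) (g t j))"
proof -
  have "profile_loglik n T g z
      = (\<Sum>t\<in>{1..T}. \<Sum>j\<in>{1..n}. ln (bernoulli_mass (A_hat T g z (z t) j) (g t j)))"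
    unfolding profile_loglik_def by (intro sum.cong refl) (auto simp: bernoulli_mass_def)
  then show ?thesis
    using bernoulli_mass_A_hat_pos by (simp add: exp_sum del: atLeastAtMost_iff cong: prod.cong)
qed

text \<open>With \<open>m\<close> groups in the cluster, those containing \<open>j\<close>
  contribute \<open>m * b\<close> in total and the others \<open>m * (1 - b)\<close>. It is an
  inequality because a class without groups contributes zero instead.\<close>

lemma sum_likelihood_ratio_le:
  assumes b: "b \<in> {0..1}"
  shows "(\<Sum>t | t \<in> {1..T} \<and> z t = i. bernoulli_mass b (g t j) / bernoulli_mass (A_hat T g z i j) (g t j))
    \<le> real (card {t \<in> {1..T}. z t = i})"
proof -
  let ?C = "{t \<in> {1..T}. z t = i}" and ?K = "{t \<in> {1..T}. z t = i \<and> g t j}"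
  let ?k = "real (card ?K)" and ?m = "real (card ?C)" and ?a = "A_hat T g z i j"
  have split: "?C = ?K \<union> (?C - ?K)" by auto
  have N: "real (card (?C - ?K)) = ?m - ?k"
    by (subst card_Diff_subset) (auto intro!: of_nat_diff card_mono)
  have "(\<Sum>t\<in>?C. bernoulli_mass b (g t j) / bernoulli_mass ?a (g t j))
      = (\<Sum>t\<in>?K. bernoulli_mass b (g t j) / bernoulli_mass ?a (g t j))
      + (\<Sum>t\<in>?C - ?K. bernoulli_mass b (g t j) / bernoulli_mass ?a (g t j))"
    by (subst split, subst sum.union_disjoint) auto
  also have "(\<Sum>t\<in>?K. bernoulli_mass b (g t j) / bernoulli_mass ?a (g t j)) = ?k * (b / ?a)"
    by (simp add: bernoulli_mass_def)
  also have "(\<Sum>t\<in>?C - ?K. bernoulli_mass b (g t j) / bernoulli_mass ?a (g t j))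
      = (\<Sum>t\<in>?C - ?K. (1 - b) / (1 - ?a))"
    by (intro sum.cong) (auto simp: bernoulli_mass_def)
  also have "\<dots> = (?m - ?k) * ((1 - b) / (1 - ?a))" by (simp only: sum_constant N)
  also have "?k * (b / ?a) + (?m - ?k) * ((1 - b) / (1 - ?a)) \<le> ?m * b + ?m * (1 - b)"
  proof (rule add_mono)
    have a: "?a = ?k / ?m" by (rule A_hat_eq)
    show "?k * (b / ?a) \<le> ?m * b" using b unfolding a by (cases "?k = 0") auto
    show "(?m - ?k) * ((1 - b) / (1 - ?a)) \<le> ?m * (1 - b)"
    proof (cases "?m = 0 \<or> ?m = ?k")
      case True
      moreover have "?k \<le> ?m" by (simp add: card_mono Collect_mono_iff)
      ultimately have "?m - ?k = 0" by linarith
      then show ?thesis using b by simp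
    next
      case False
      then have "1 - ?a = (?m - ?k) / ?m" unfolding a by (simp add: field_simps)
      then show ?thesis using False by simp
    qed
  qed
  finally show ?thesis by (simp add: algebra_simps)
qed

text \<open>Each ratio \<open>r\<close> satisfies \<open>r \<le> exp (r - 1)\<close>, also when
  \<open>r = 0\<close>. For a fixed node the ratios sum to at most \<open>T\<close> over the groups,
  so the exponents sum to at most zero and the product of all ratios is at most one.\<close>

lemma likelihood_le_profile:
  assumes B: "\<And>t j. t \<in> {1..T} \<Longrightarrow> j \<in> {1..n} \<Longrightarrow> B (z t) j \<in> {0..1}"
  shows "(\<Prod>t\<in>{1..T}. \<Prod>j\<in>{1..n}. bernoulli_mass (B (z t) j) (g t j)) \<le> exp (profile_loglik n T g z)"
proof -
  let ?r = "\<lambda>t j. bernoulli_mass (B (z t) j) (g t j) / bernoulli_mass (A_hat T g z (z t) j) (g t j)"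
  have r0: "0 \<le> ?r t j" if "t \<in> {1..T}" "j \<in> {1..n}" for t j
    using bernoulli_mass_nonneg[OF B[OF that]] bernoulli_mass_A_hat_pos[OF that(1)]
    by (intro divide_nonneg_pos) auto
  have row: "(\<Sum>t\<in>{1..T}. ?r t j) \<le> real T" if j: "j \<in> {1..n}" for j
  proof -
    \<comment> \<open>Within one cluster the fitted entry and \<open>B\<close> are constant, so the
      cluster bound applies and the cluster sizes add up to \<open>T\<close>.\<close>
    have "(\<Sum>t\<in>{1..T}. ?r t j) = (\<Sum>i\<in>z ` {1..T}. \<Sum>t | t \<in> {1..T} \<and> z t = i. ?r t j)"
      by (subst sum.group) auto
    also have "\<dots> = (\<Sum>i\<in>z ` {1..T}. \<Sum>t | t \<in> {1..T} \<and> z t = i.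
        bernoulli_mass (B i j) (g t j) / bernoulli_mass (A_hat T g z i j) (g t j))"
      by (intro sum.cong) auto
    also have "\<dots> \<le> (\<Sum>i\<in>z ` {1..T}. real (card {t \<in> {1..T}. z t = i}))"
      using B j by (intro sum_mono sum_likelihood_ratio_le) blast
    also have "\<dots> = (\<Sum>i\<in>z ` {1..T}. \<Sum>t | t \<in> {1..T} \<and> z t = i. 1)" by simp
    also have "\<dots> = real T" by (subst sum.group) auto
    finally show ?thesis .
  qed
  have "(\<Prod>t\<in>{1..T}. \<Prod>j\<in>{1..n}. ?r t j) \<le> (\<Prod>t\<in>{1..T}. \<Prod>j\<in>{1..n}. exp (?r t j - 1))"
    using r0 exp_ge_add_one_self[of "?r t j - 1" for t j]
    by (intro prod_mono conjI prod_nonneg) auto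
  also have "\<dots> = exp (\<Sum>t\<in>{1..T}. \<Sum>j\<in>{1..n}. ?r t j - 1)" by (simp add: exp_sum)
  also have "(\<Sum>t\<in>{1..T}. \<Sum>j\<in>{1..n}. ?r t j - 1) = (\<Sum>j\<in>{1..n}. (\<Sum>t\<in>{1..T}. ?r t j) - real T)"
    by (subst sum.swap) (simp add: sum_subtractf)
  also have "exp \<dots> \<le> exp 0"
    unfolding exp_le_cancel_iff using row by (intro sum_nonpos) (simp del: atLeastAtMost_iff)
  finally have le: "(\<Prod>t\<in>{1..T}. \<Prod>j\<in>{1..n}. ?r t j) \<le> 1" by simp
  have "(\<Prod>t\<in>{1..T}. \<Prod>j\<in>{1..n}. bernoulli_mass (B (z t) j) (g t j))
      = (\<Prod>t\<in>{1..T}. \<Prod>j\<in>{1..n}. ?r t j) * exp (profile_loglik n T g z)"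
    unfolding exp_profile_loglik prod.distrib[symmetric]
    using bernoulli_mass_A_hat_pos by (intro prod.cong refl) (simp add: less_imp_neq[symmetric])
  also have "\<dots> \<le> exp (profile_loglik n T g z)" using le by simp
  finally show ?thesis .
qed

lemma mle_likelihood_ge:
  assumes mle: "is_profile_mle nL n T g zh" and \<zeta>: "feasible nL T g \<zeta>"
    and B: "\<And>t j. t \<in> {1..T} \<Longrightarrow> j \<in> {1..n} \<Longrightarrow> B (\<zeta> t) j \<in> {0..1}"
  shows "(\<Prod>t\<in>{1..T}. \<Prod>j\<in>{1..n}. bernoulli_mass (B (\<zeta> t) j) (g t j))
    \<le> (\<Prod>t\<in>{1..T}. \<Prod>j\<in>{1..n}. bernoulli_mass (A_hat T g zh (zh t) j) (g t j))"
proof -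
  have "(\<Prod>t\<in>{1..T}. \<Prod>j\<in>{1..n}. bernoulli_mass (B (\<zeta> t) j) (g t j)) \<le> exp (profile_loglik n T g \<zeta>)"
    using B by (rule likelihood_le_profile)
  also have "\<dots> \<le> exp (profile_loglik n T g zh)"
    using mle \<zeta> by (auto simp: is_profile_mle_def is_arg_max_def not_less)
  finally show ?thesis by (simp only: exp_profile_loglik)
qed

section \<open>Deterministic bound on the number of mislabeled groups by the squared misfit\<close>

lemma sum_square_deviation_mean_le:
  fixes x :: "'b \<Rightarrow> real"
  shows "(\<Sum>t\<in>C. (x t - (\<Sum>s\<in>C. x s) / real (card C))\<^sup>2) \<le> (\<Sum>t\<in>C. (x t - b)\<^sup>2)"
proof (cases "card C = 0")
  case True
  then show ?thesis by (auto simp: card_eq_0_iff)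
next
  case False
  define a where "a = (\<Sum>s\<in>C. x s) / real (card C)"
  have "(\<Sum>t\<in>C. (x t - b)\<^sup>2) = (\<Sum>t\<in>C. (x t - a)\<^sup>2 + (2 * (a - b) * x t + (b\<^sup>2 - a\<^sup>2)))"
    by (intro sum.cong) (auto simp: power2_eq_square algebra_simps)
  also have "\<dots> = (\<Sum>t\<in>C. (x t - a)\<^sup>2) + (2 * (a - b) * (\<Sum>t\<in>C. x t) + real (card C) * (b\<^sup>2 - a\<^sup>2))"
    by (simp add: sum.distrib sum_distrib_left)
  also have "(\<Sum>t\<in>C. x t) = real (card C) * a" using False by (simp add: a_def)
  also have "2 * (a - b) * (real (card C) * a) + real (card C) * (b\<^sup>2 - a\<^sup>2) = real (card C) * (a - b)\<^sup>2"
    by (simp add: power2_eq_square algebra_simps)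
  finally show ?thesis by (simp add: a_def)
qed

text \<open>
  A cluster of size at least \<open>2 * S\<close> pays for each of its mislabeled groups, because no wrong
  hub accounts for more than half of it; smaller clusters contain few groups altogether.
\<close>

lemma mislabeled_in_cluster_le:
  fixes A :: "nat \<Rightarrow> nat \<Rightarrow> real" and B :: "nat \<Rightarrow> real"
  assumes fin: "finite C"
    and \<zeta>: "\<And>t. t \<in> C \<Longrightarrow> \<zeta> t \<in> {1..nL}"
    and S: "\<And>k. k \<in> {1..nL} \<Longrightarrow> k \<noteq> i \<Longrightarrow> real (card {t \<in> C. \<zeta> t = k}) \<le> S"
    and sep: "\<And>k. k \<in> {1..nL} \<Longrightarrow> \<exists>V \<subseteq> {1..n}. w \<le> real (card V) \<and>
           (\<forall>j\<in>V. \<forall>k'\<in>{1..nL}. k' \<noteq> k \<longrightarrow> d \<le> A k j - A k' j)"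
    and pos: "0 < w" "0 < d" "0 \<le> S"
  shows "real (card {t \<in> C. \<zeta> t \<noteq> i})
    \<le> 2 * S + 4 / (d\<^sup>2 * w) * (\<Sum>t\<in>C. \<Sum>j\<in>{1..n}. (A (\<zeta> t) j - B j)\<^sup>2)"
\<comment> \<open>The empty cluster is listed separately since the size condition misses it when
  \<open>S = 0\<close>; the other case divides by the cluster size.\<close>
proof (cases "real (card C) < 2 * S \<or> C = {}")
  case True
  have "real (card {t \<in> C. \<zeta> t \<noteq> i}) \<le> real (card C)" using fin by (auto intro!: card_mono)
  also have "\<dots> \<le> 2 * S" using True pos by auto
  also have "\<dots> \<le> 2 * S + 4 / (d\<^sup>2 * w) * (\<Sum>t\<in>C. \<Sum>j\<in>{1..n}. (A (\<zeta> t) j - B j)\<^sup>2)"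
    using pos by (auto intro!: mult_nonneg_nonneg divide_nonneg_nonneg sum_nonneg)
  finally show ?thesis .
next
  case False
  define m where "m = real (card C)"
  have m: "0 < m" "2 * S \<le> m" using False fin by (auto simp: m_def card_gt_0_iff)
  define a where "a j = (\<Sum>s\<in>C. A (\<zeta> s) j) / m" for j
  have loss: "w * d\<^sup>2 / 4 \<le> (\<Sum>j\<in>{1..n}. (A (\<zeta> t) j - a j)\<^sup>2)" if t: "t \<in> C" "\<zeta> t \<noteq> i" for t
  proof -
    obtain V where V: "V \<subseteq> {1..n}" "w \<le> real (card V)"
      "\<And>j k'. j \<in> V \<Longrightarrow> k' \<in> {1..nL} \<Longrightarrow> k' \<noteq> \<zeta> t \<Longrightarrow> d \<le> A (\<zeta> t) j - A k' j"
      using sep[OF \<zeta>[OF t(1)]] by blast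
    \<comment> \<open>On \<open>V\<close> every hub other than \<open>\<zeta> t\<close> lies at
      least \<open>d\<close> lower, and such hubs make up at least half of the cluster, so the
      cluster mean lies at least \<open>d / 2\<close> lower.\<close>
    have gap: "d / 2 \<le> A (\<zeta> t) j - a j" if j: "j \<in> V" for j
    proof -
      let ?c = "real (card {s \<in> C. \<zeta> s = \<zeta> t})"
      have c: "?c \<le> m / 2" using S[OF \<zeta>[OF t(1)] t(2)] m by linarith
      have "d * (m / 2) \<le> d * (m - ?c)" using c pos by (intro mult_left_mono) auto
      also have "\<dots> = (\<Sum>s\<in>C. d - (if \<zeta> s = \<zeta> t then d else 0))"
        using fin by (simp add: sum_subtractf m_def sum.If_cases Int_def algebra_simps)
      also have "\<dots> \<le> (\<Sum>s\<in>C. A (\<zeta> t) j - A (\<zeta> s) j)"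
        using V(3)[OF j \<zeta>] by (intro sum_mono) auto
      also have "\<dots> = m * (A (\<zeta> t) j - a j)"
        using m by (simp add: sum_subtractf a_def m_def algebra_simps)
      finally have "m * (d / 2) \<le> m * (A (\<zeta> t) j - a j)" by (simp add: mult.commute)
      then show ?thesis using m by (simp add: mult_le_cancel_left)
    qed
    have "w * d\<^sup>2 / 4 \<le> real (card V) * (d / 2)\<^sup>2"
      using V(2) by (simp add: power_divide mult_right_mono)
    also have "\<dots> = (\<Sum>j\<in>V. (d / 2)\<^sup>2)" by simp
    also have "\<dots> \<le> (\<Sum>j\<in>V. (A (\<zeta> t) j - a j)\<^sup>2)"
      using gap pos by (intro sum_mono power_mono) auto
    also have "\<dots> \<le> (\<Sum>j\<in>{1..n}. (A (\<zeta> t) j - a j)\<^sup>2)" using V(1) by (intro sum_mono2) auto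
    finally show ?thesis .
  qed
  have "real (card {t \<in> C. \<zeta> t \<noteq> i}) * (w * d\<^sup>2 / 4) = (\<Sum>t | t \<in> C \<and> \<zeta> t \<noteq> i. w * d\<^sup>2 / 4)" by simp
  also have "\<dots> \<le> (\<Sum>t | t \<in> C \<and> \<zeta> t \<noteq> i. \<Sum>j\<in>{1..n}. (A (\<zeta> t) j - a j)\<^sup>2)"
    using loss by (intro sum_mono) auto
  also have "\<dots> \<le> (\<Sum>t\<in>C. \<Sum>j\<in>{1..n}. (A (\<zeta> t) j - a j)\<^sup>2)"
    using fin by (intro sum_mono2) (auto intro!: sum_nonneg)
  also have "\<dots> = (\<Sum>j\<in>{1..n}. \<Sum>t\<in>C. (A (\<zeta> t) j - a j)\<^sup>2)" by (rule sum.swap)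
  \<comment> \<open>The loss was computed against the cluster mean of the true rows; the mean
    minimizes the squared deviation, so an arbitrary fitted row \<open>B\<close> does no
    better.\<close>
  also have "\<dots> \<le> (\<Sum>j\<in>{1..n}. \<Sum>t\<in>C. (A (\<zeta> t) j - B j)\<^sup>2)"
    unfolding a_def m_def by (intro sum_mono sum_square_deviation_mean_le)
  also have "\<dots> = (\<Sum>t\<in>C. \<Sum>j\<in>{1..n}. (A (\<zeta> t) j - B j)\<^sup>2)" by (rule sum.swap)
  finally have "real (card {t \<in> C. \<zeta> t \<noteq> i}) \<le> (\<Sum>t\<in>C. \<Sum>j\<in>{1..n}. (A (\<zeta> t) j - B j)\<^sup>2) / (w * d\<^sup>2 / 4)"
    using pos by (subst pos_le_divide_eq) auto
  also have "\<dots> = 4 / (d\<^sup>2 * w) * (\<Sum>t\<in>C. \<Sum>j\<in>{1..n}. (A (\<zeta> t) j - B j)\<^sup>2)"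
    by (simp add: mult.commute)
  finally show ?thesis using pos(3) by linarith
qed

text \<open>The cluster bounds are summed: the allowance \<open>2 * S\<close> is paid once for each
  of the \<open>nL\<close> clusters, and the misfits of the clusters add up to the total
  misfit.\<close>

lemma mislabeled_le:
  fixes A B :: "nat \<Rightarrow> nat \<Rightarrow> real"
  assumes \<zeta>: "\<And>t. t \<in> {1..T} \<Longrightarrow> \<zeta> t \<in> {1..nL}" and z: "\<And>t. t \<in> {1..T} \<Longrightarrow> z t \<in> {1..nL}"
    and S: "\<And>k i. k \<in> {1..nL} \<Longrightarrow> i \<in> {1..nL} \<Longrightarrow> k \<noteq> i \<Longrightarrow>
        real (card {t \<in> {1..T}. \<zeta> t = k \<and> z t = i}) \<le> S"
    and sep: "\<And>k. k \<in> {1..nL} \<Longrightarrow> \<exists>V \<subseteq> {1..n}. w \<le> real (card V) \<and>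
           (\<forall>j\<in>V. \<forall>k'\<in>{1..nL}. k' \<noteq> k \<longrightarrow> d \<le> A k j - A k' j)"
    and pos: "0 < w" "0 < d" "0 \<le> S"
  shows "real (mislabeled T \<zeta> z)
    \<le> 2 * S * real nL + 4 / (d\<^sup>2 * w) * (\<Sum>t\<in>{1..T}. \<Sum>j\<in>{1..n}. (A (\<zeta> t) j - B (z t) j)\<^sup>2)"
proof -
  let ?C = "\<lambda>i. {t. t \<in> {1..T} \<and> z t = i}"
  have group: "(\<Sum>i\<in>{1..nL}. \<Sum>t\<in>?C i. f t) = (\<Sum>t\<in>{1..T}. f t)" for f :: "nat \<Rightarrow> real"
    using z by (intro sum.group) auto
  have "real (mislabeled T \<zeta> z) = (\<Sum>t\<in>{1..T}. of_bool (\<zeta> t \<noteq> z t))"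
    by (simp add: mislabeled_def Int_def)
  also have "\<dots> = (\<Sum>i\<in>{1..nL}. \<Sum>t\<in>?C i. of_bool (\<zeta> t \<noteq> z t))" by (rule group[symmetric])
  also have "\<dots> = (\<Sum>i\<in>{1..nL}. \<Sum>t\<in>?C i. of_bool (\<zeta> t \<noteq> i))" by (intro sum.cong) auto
  also have "\<dots> = (\<Sum>i\<in>{1..nL}. real (card {t \<in> ?C i. \<zeta> t \<noteq> i}))"
    by (simp add: Int_def)
  also have "\<dots> \<le> (\<Sum>i\<in>{1..nL}. 2 * S + 4 / (d\<^sup>2 * w) * (\<Sum>t\<in>?C i. \<Sum>j\<in>{1..n}. (A (\<zeta> t) j - B i j)\<^sup>2))"
  proof (intro sum_mono mislabeled_in_cluster_le[OF _ _ _ sep pos])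
    fix i k assume "i \<in> {1..nL}" "k \<in> {1..nL}" "k \<noteq> i"
    moreover have "{t \<in> ?C i. \<zeta> t = k} = {t \<in> {1..T}. \<zeta> t = k \<and> z t = i}" by auto
    ultimately show "real (card {t \<in> ?C i. \<zeta> t = k}) \<le> S" using S by simp
  qed (use \<zeta> in auto)
  also have "\<dots> = 2 * S * real nL
      + 4 / (d\<^sup>2 * w) * (\<Sum>i\<in>{1..nL}. \<Sum>t\<in>?C i. \<Sum>j\<in>{1..n}. (A (\<zeta> t) j - B i j)\<^sup>2)"
    by (simp add: sum.distrib sum_distrib_left mult_ac)
  also have "(\<Sum>i\<in>{1..nL}. \<Sum>t\<in>?C i. \<Sum>j\<in>{1..n}. (A (\<zeta> t) j - B i j)\<^sup>2)
      = (\<Sum>i\<in>{1..nL}. \<Sum>t\<in>?C i. \<Sum>j\<in>{1..n}. (A (\<zeta> t) j - B (z t) j)\<^sup>2)"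
    by (intro sum.cong) auto
  also have "\<dots> = (\<Sum>t\<in>{1..T}. \<Sum>j\<in>{1..n}. (A (\<zeta> t) j - B (z t) j)\<^sup>2)" by (rule group)
  finally show ?thesis .
qed

section \<open>Tail bounds for the number of mislabeled groups\<close>

context asymmetric_hub_model
begin

text \<open>Outside the two exceptional events the misfit is below \<open>4 * x\<close> and every
  confusion count is at most \<open>S\<close>, so the deterministic bound applies;
  \<open>16 * x\<close> is the factor 4 of that bound times \<open>4 * x\<close>.\<close>

lemma mislabeled_tail:
  assumes mle: "AE \<omega> in M. is_profile_mle nL n T (\<lambda>t j. G t j \<omega>) (\<lambda>t. Zhat t \<omega>)"
    and a: "\<And>k i. k \<in> {1..nL} \<Longrightarrow> i \<in> {1..nL} \<Longrightarrow> k \<noteq> i \<Longrightarrow> \<rho> k * A k i \<le> a"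
    and sep: "\<And>k. k \<in> {1..nL} \<Longrightarrow> \<exists>V \<subseteq> {1..n}. w \<le> real (card V) \<and>
           (\<forall>j\<in>V. \<forall>k'\<in>{1..nL}. k' \<noteq> k \<longrightarrow> d \<le> A k j - A k' j)"
    and pos: "0 < w" "0 < d" "0 \<le> S"
    and y: "2 * S * real nL + 16 * x / (d\<^sup>2 * w) \<le> y"
  shows "prob {\<omega> \<in> space M. y < real (mislabeled T (\<lambda>t. Z t \<omega>) (\<lambda>t. Zhat t \<omega>))}
    \<le> real nL ^ T * real (T + 1) ^ (2 * (nL * n)) * exp (- x)
      + (real nL)\<^sup>2 * exp (2 * (real T * a) - S)"
proof -
  let ?K = "misfit_event x \<union> wrong_leader_event S"
  have fin: "finite (misfit_event x)" "finite (wrong_leader_event S)"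
    by (rule finite_subset[of _ "assignments \<times> observations"]; force simp: misfit_event_def wrong_leader_event_def)+
  have "prob {\<omega> \<in> space M. y < real (mislabeled T (\<lambda>t. Z t \<omega>) (\<lambda>t. Zhat t \<omega>))}
      \<le> (\<Sum>(\<zeta>, g)\<in>?K. cell_mass \<zeta> g)"
  proof (rule prob_le_sum_cell_mass)
    show "?K \<subseteq> assignments \<times> observations" by (auto simp: misfit_event_def wrong_leader_event_def)
    show "AE \<omega> in M. \<omega> \<in> {\<omega> \<in> space M. y < real (mislabeled T (\<lambda>t. Z t \<omega>) (\<lambda>t. Zhat t \<omega>))} \<longrightarrow> (\<exists>(\<zeta>, g)\<in>?K. \<omega> \<in> cell \<zeta> g)"
      using AE_cell_mass_pos mle
    proof eventually_elim
      case (elim \<omega>)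
      then obtain \<zeta> g where \<zeta>: "\<zeta> \<in> assignments" and g: "g \<in> observations"
        and \<omega>: "\<omega> \<in> cell \<zeta> g" and mass: "0 < cell_mass \<zeta> g" by blast
      let ?G = "\<lambda>t j. G t j \<omega>" and ?zh = "\<lambda>t. Zhat t \<omega>"
      \<comment> \<open>Extensional copies of the estimator and of its frequencies, so that they
        belong to the finite families in \<open>misfit_event\<close>.\<close>
      define z where "z = restrict ?zh {1..T}"
      define B where "B = (\<lambda>i\<in>{1..nL}. \<lambda>j\<in>{1..n}. A_hat T ?G ?zh i j)"
      have \<zeta>_range: "\<zeta> t \<in> {1..nL}" if "t \<in> {1..T}" for t
        using \<zeta> that by (auto simp: assignments_def)
      have ZG: "Z t \<omega> = \<zeta> t" "j \<in> {1..n} \<Longrightarrow> G t j \<omega> = g t j" if "t \<in> {1..T}" for t j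
        using \<omega> that by (auto simp: cell_def)
      have zh: "Zhat t \<omega> \<in> {1..nL}" "G t (Zhat t \<omega>) \<omega>" if "t \<in> {1..T}" for t
        using elim(2) that by (auto simp: is_profile_mle_def is_arg_max_def feasible_def)
      have leader_n: "i \<in> {1..n}" if "i \<in> {1..nL}" for i using that nL_le_n by auto
      \<comment> \<open>By \<open>A_diag\<close>, a hub absent from its own group would put a zero
        factor into the positive mass of the cell.\<close>
      have feas: "feasible nL T ?G \<zeta>"
        unfolding feasible_def
      proof (intro ballI conjI)
        fix t assume t: "t \<in> {1..T}"
        show "\<zeta> t \<in> {1..nL}" using \<zeta>_range[OF t] .
        have "(\<Prod>j\<in>{1..n}. bernoulli_mass (A (\<zeta> t) j) (g t j)) \<noteq> 0"
          using mass t unfolding cell_mass_def by (auto simp: less_le)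
        then have "bernoulli_mass (A (\<zeta> t) (\<zeta> t)) (g t (\<zeta> t)) \<noteq> 0"
          using leader_n[OF \<zeta>_range[OF t]] by auto
        then show "G t (\<zeta> t) \<omega>"
          using A_diag[OF \<zeta>_range[OF t]] ZG(2)[OF t leader_n[OF \<zeta>_range[OF t]]]
          by (auto simp: bernoulli_mass_def split: if_splits)
      qed
      have z: "z \<in> assignments" using zh by (auto simp: z_def assignments_def)
      have B: "B \<in> {1..nL} \<rightarrow>\<^sub>E ({1..n} \<rightarrow>\<^sub>E frequencies T)"
        by (auto simp: B_def A_hat_frequencies)
      have lik: "(\<Prod>t\<in>{1..T}. \<Prod>j\<in>{1..n}. bernoulli_mass (A (\<zeta> t) j) (g t j))
          \<le> (\<Prod>t\<in>{1..T}. \<Prod>j\<in>{1..n}. bernoulli_mass (B (z t) j) (g t j))"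
      proof -
        have "(\<Prod>t\<in>{1..T}. \<Prod>j\<in>{1..n}. bernoulli_mass (A (\<zeta> t) j) (?G t j))
            \<le> (\<Prod>t\<in>{1..T}. \<Prod>j\<in>{1..n}. bernoulli_mass (A_hat T ?G ?zh (?zh t) j) (?G t j))"
          using A_range[OF \<zeta>_range] by (intro mle_likelihood_ge[OF elim(2) feas]) auto
        moreover have "(\<Prod>t\<in>{1..T}. \<Prod>j\<in>{1..n}. bernoulli_mass (A (\<zeta> t) j) (?G t j))
            = (\<Prod>t\<in>{1..T}. \<Prod>j\<in>{1..n}. bernoulli_mass (A (\<zeta> t) j) (g t j))"
          using ZG(2) by (intro prod.cong refl) (simp del: atLeastAtMost_iff)
        moreover have "(\<Prod>t\<in>{1..T}. \<Prod>j\<in>{1..n}. bernoulli_mass (A_hat T ?G ?zh (?zh t) j) (?G t j))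
            = (\<Prod>t\<in>{1..T}. \<Prod>j\<in>{1..n}. bernoulli_mass (B (z t) j) (g t j))"
          using ZG(2) zh(1) by (intro prod.cong refl) (simp add: B_def z_def del: atLeastAtMost_iff)
        ultimately show ?thesis by simp
      qed
      show ?case
      proof (rule impI, rule ccontr)
        assume E: "\<omega> \<in> {\<omega> \<in> space M. y < real (mislabeled T (\<lambda>t. Z t \<omega>) (\<lambda>t. Zhat t \<omega>))}"
        assume "\<not> (\<exists>(\<zeta>, g)\<in>?K. \<omega> \<in> cell \<zeta> g)"
        then have notK: "(\<zeta>, g) \<notin> misfit_event x" "(\<zeta>, g) \<notin> wrong_leader_event S" using \<omega> by auto
        have D: "(\<Sum>t\<in>{1..T}. \<Sum>j\<in>{1..n}. (A (\<zeta> t) j - B (z t) j)\<^sup>2) < 4 * x"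
        proof (rule ccontr)
          assume "\<not> ?thesis"
          then have "(\<zeta>, g) \<in> misfit_event x"
            unfolding misfit_event_def mem_Collect_eq case_prod_conv using \<zeta> g z B lik
            by (intro conjI bexI[of _ z] bexI[of _ B] SigmaI) (auto simp only: not_less)
          then show False using notK(1) by contradiction
        qed
        have few: "real (card {t \<in> {1..T}. \<zeta> t = k \<and> z t = i}) \<le> S"
          if ki: "k \<in> {1..nL}" "i \<in> {1..nL}" "k \<noteq> i" for k i
        proof -
          \<comment> \<open>The estimator is feasible, so a group assigned to \<open>i\<close>
            contains \<open>i\<close>.\<close>
          have "{t \<in> {1..T}. \<zeta> t = k \<and> z t = i} \<subseteq> {t \<in> {1..T}. \<zeta> t = k \<and> g t i}"
            using zh ZG(2) leader_n[OF ki(2)] by (auto simp: z_def simp del: atLeastAtMost_iff)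
          then have "card {t \<in> {1..T}. \<zeta> t = k \<and> z t = i} \<le> card {t \<in> {1..T}. \<zeta> t = k \<and> g t i}"
            by (rule card_mono[rotated]) simp
          moreover have "real (card {t \<in> {1..T}. \<zeta> t = k \<and> g t i}) < S"
          proof (rule ccontr)
            assume "\<not> ?thesis"
            then have "(\<zeta>, g) \<in> wrong_leader_event S"
              unfolding wrong_leader_event_def mem_Collect_eq case_prod_conv using \<zeta> g ki
              by (intro conjI bexI[of _ k] bexI[of _ i] SigmaI) (auto simp only: not_less)
            then show False using notK(2) by contradiction
          qed
          ultimately show ?thesis by linarith
        qed
        have "real (mislabeled T \<zeta> z) \<le> 2 * S * real nL
            + 4 / (d\<^sup>2 * w) * (\<Sum>t\<in>{1..T}. \<Sum>j\<in>{1..n}. (A (\<zeta> t) j - B (z t) j)\<^sup>2)"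
          using \<zeta>_range few sep pos zh by (intro mislabeled_le) (auto simp: z_def simp del: atLeastAtMost_iff)
        also have "\<dots> \<le> 2 * S * real nL + 4 / (d\<^sup>2 * w) * (4 * x)"
          using D pos by (intro add_left_mono mult_left_mono) auto
        also have "mislabeled T \<zeta> z = mislabeled T (\<lambda>t. Z t \<omega>) ?zh"
          unfolding mislabeled_def using ZG(1) by (intro arg_cong[where f=card] Collect_cong) (auto simp: z_def)
        finally show False using E y by simp
      qed
    qed
  qed
  also have "\<dots> \<le> (\<Sum>(\<zeta>, g)\<in>misfit_event x. cell_mass \<zeta> g) + (\<Sum>(\<zeta>, g)\<in>wrong_leader_event S. cell_mass \<zeta> g)"
    using fin by (subst sum_Un) (auto intro!: sum_nonneg cell_mass_nonneg simp: misfit_event_def)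
  also have "\<dots> \<le> real nL ^ T * real (T + 1) ^ (2 * (nL * n)) * exp (- x)
      + (real nL)\<^sup>2 * exp (2 * (real T * a) - S)"
    using a by (intro add_mono misfit_event_mass wrong_leader_event_mass)
  finally show ?thesis .
qed

end

text \<open>Fixes \<open>S\<close> and \<open>x\<close> so that the failure probability vanishes
  with growing \<open>nL\<close> and \<open>T\<close>, while the threshold is expressed by the given
  rates.\<close>

lemma (in asymmetric_hub_model) mislabeled_fraction_tail:
  assumes mle: "AE \<omega> in M. is_profile_mle nL n T (\<lambda>t j. G t j \<omega>) (\<lambda>t. Zhat t \<omega>)"
    and rho_le: "\<And>k. k \<in> {1..nL} \<Longrightarrow> \<rho> k \<le> c / real nL"
    and A_le: "\<And>k i. k \<in> {1..nL} \<Longrightarrow> i \<in> {1..nL} \<Longrightarrow> k \<noteq> i \<Longrightarrow> A k i \<le> c' / real nL"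
    and sep: "\<And>k. k \<in> {1..nL} \<Longrightarrow> \<exists>V \<subseteq> {1..n}. v * real n / real nL \<le> real (card V) \<and>
           (\<forall>j\<in>V. \<forall>k'\<in>{1..nL}. k' \<noteq> k \<longrightarrow> d \<le> A k j - A k' j)"
    and d: "d \<in> {0<..1}" and v: "v \<in> {0<..1}" and c: "0 \<le> c" "0 \<le> c'"
    and large: "3 \<le> nL" "2 \<le> T"
    and rate1: "(real nL)\<^sup>2 * ln (real nL) / real T \<le> 1 / 4"
    and \<tau>: "2 * (2 * (c * c') + 1) / real nL
        + 64 * ((real nL)\<^sup>2 * ln (real T) / (d\<^sup>2 * v * real T))
        + 32 * ((real nL)\<^sup>2 * ln (real nL) / (d ^ 4 * v\<^sup>2 * real n)) \<le> \<epsilon>"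
  shows "prob {\<omega> \<in> space M. \<epsilon> < real (mislabeled T (\<lambda>t. Z t \<omega>) (\<lambda>t. Zhat t \<omega>)) / real T}
    \<le> exp (- real T) + 1 / real nL"
proof -
  define N \<theta> where "N = real nL" and "\<theta> = real T"
  \<comment> \<open>Twice the bound \<open>c * c' / N\<^sup>2\<close> times \<open>\<theta>\<close>,
    to absorb the exponential moment, plus \<open>\<theta> / N\<^sup>2\<close>, which remains as
    decay.\<close>
  define S where "S = (2 * (c * c') + 1) * \<theta> / N\<^sup>2"
  \<comment> \<open>The first two terms are the logarithms of the numbers of assignments and
    frequency tables in the union bound; the last leaves \<open>exp (- \<theta>)\<close>.\<close>
  define x where "x = \<theta> * ln N + 2 * N * real n * ln (\<theta> + 1) + \<theta>"
  define w where "w = v * real n / N"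
  have N: "3 \<le> N" and \<theta>: "2 \<le> \<theta>" and n: "0 < real n" and d0: "0 < d" "d \<le> 1" and v0: "0 < v" "v \<le> 1"
    using large d v n_pos by (auto simp: N_def \<theta>_def)
  \<comment> \<open>This is where \<open>3 \<le> nL\<close> enters, through
    \<open>exp 1 \<le> 3\<close>.\<close>
  have lnN: "1 \<le> ln N"
    using N exp_le by (subst ln_ge_iff) auto
  have pos: "0 < w" "0 < d" "0 \<le> S"
    using N \<theta> n d0 v0 c by (auto simp: w_def S_def)
  have a: "\<rho> k * A k i \<le> c * c' / N\<^sup>2" if ki: "k \<in> {1..nL}" "i \<in> {1..nL}" "k \<noteq> i" for k i
  proof -
    have "\<rho> k * A k i \<le> c / N * (c' / N)"
      using ki nL_le_n A_range[OF ki(1), of i] c N unfolding N_def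
      by (intro mult_mono rho_le A_le rho_nonneg) auto
    then show ?thesis by (simp add: power2_eq_square)
  qed
  have sep': "\<exists>V \<subseteq> {1..n}. w \<le> real (card V) \<and>
           (\<forall>j\<in>V. \<forall>k'\<in>{1..nL}. k' \<noteq> k \<longrightarrow> d \<le> A k j - A k' j)" if "k \<in> {1..nL}" for k
    using sep[OF that] by (simp add: w_def N_def)
  \<comment> \<open>Two terms of \<open>x\<close> are dominated by the third rate, since
    \<open>d\<close> and \<open>v\<close> are at most one and \<open>1 \<le> ln N\<close>; this
    gives 32 as twice 16. The remaining one uses
    \<open>ln (\<theta> + 1) \<le> 2 * ln \<theta>\<close>, which turns 32 into 64.\<close>
  have thr: "2 * S * N + 16 * x / (d\<^sup>2 * w) \<le> \<epsilon> * \<theta>"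
  proof -
    have dv: "d ^ 4 * v\<^sup>2 \<le> d\<^sup>2 * v" "0 < d ^ 4 * v\<^sup>2"
      using d0 v0 by (auto intro!: mult_mono power_decreasing power_decreasing[of 1 2 v, simplified])
    have "N \<le> N * N" using N by simp
    then have r3: "N * ln N / (d\<^sup>2 * v * real n) \<le> N\<^sup>2 * ln N / (d ^ 4 * v\<^sup>2 * real n)"
      using dv n lnN N by (intro frac_le mult_right_mono mult_nonneg_nonneg mult_pos_pos[OF dv(2)]) (auto simp: power2_eq_square)
    have r3': "N / (d\<^sup>2 * v * real n) \<le> N * ln N / (d\<^sup>2 * v * real n)"
      using lnN N d0 v0 n by (intro divide_right_mono) auto
    have "2 * \<theta> \<le> \<theta> * \<theta>" using \<theta> by (intro mult_right_mono) auto
    then have "\<theta> + 1 \<le> \<theta>\<^sup>2" using \<theta> unfolding power2_eq_square by linarith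
    then have "ln (\<theta> + 1) \<le> ln (\<theta>\<^sup>2)" using \<theta> by (subst ln_le_cancel_iff) auto
    also have "\<dots> = 2 * ln \<theta>" using \<theta> by (simp add: ln_realpow)
    finally have "N\<^sup>2 * ln (\<theta> + 1) / (d\<^sup>2 * v * \<theta>) \<le> N\<^sup>2 * (2 * ln \<theta>) / (d\<^sup>2 * v * \<theta>)"
      using d0 v0 \<theta> by (intro divide_right_mono mult_left_mono) auto
    then have r2: "N\<^sup>2 * ln (\<theta> + 1) / (d\<^sup>2 * v * \<theta>) \<le> 2 * (N\<^sup>2 * ln \<theta> / (d\<^sup>2 * v * \<theta>))"
      by (simp add: mult_ac)
    have "2 * S * N + 16 * x / (d\<^sup>2 * w) = \<theta> * (2 * (2 * (c * c') + 1) / N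
        + 16 * (N * ln N / (d\<^sup>2 * v * real n)) + 32 * (N\<^sup>2 * ln (\<theta> + 1) / (d\<^sup>2 * v * \<theta>))
        + 16 * (N / (d\<^sup>2 * v * real n)))"
      using N \<theta> n d0 v0 unfolding S_def x_def w_def by (simp add: field_simps power2_eq_square)
    also have "\<dots> \<le> \<theta> * \<epsilon>"
      using r2 r3 r3' \<tau> \<theta> unfolding N_def[symmetric] \<theta>_def[symmetric] by (intro mult_left_mono) linarith+
    finally show ?thesis by (simp add: mult.commute)
  qed
  have "prob {\<omega> \<in> space M. \<epsilon> < real (mislabeled T (\<lambda>t. Z t \<omega>) (\<lambda>t. Zhat t \<omega>)) / real T}
      = prob {\<omega> \<in> space M. \<epsilon> * \<theta> < real (mislabeled T (\<lambda>t. Z t \<omega>) (\<lambda>t. Zhat t \<omega>))}"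
    using \<theta> by (simp add: pos_less_divide_eq \<theta>_def)
  also have "\<dots> \<le> N ^ T * (\<theta> + 1) ^ (2 * (nL * n)) * exp (- x)
      + N\<^sup>2 * exp (2 * (\<theta> * (c * c' / N\<^sup>2)) - S)"
    using mislabeled_tail[OF mle a sep' pos, of x "\<epsilon> * \<theta>"] thr by (simp add: N_def \<theta>_def add.commute)
  also have "N ^ T * (\<theta> + 1) ^ (2 * (nL * n)) * exp (- x) = exp (- \<theta>)"
  proof -
    have "N ^ T = exp (\<theta> * ln N)" using N by (simp add: \<theta>_def exp_of_nat_mult)
    moreover have "(\<theta> + 1) ^ (2 * (nL * n)) = exp (2 * N * real n * ln (\<theta> + 1))"
      using \<theta> exp_of_nat_mult[of "2 * (nL * n)" "ln (\<theta> + 1)"] by (simp add: N_def mult.assoc)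
    ultimately show ?thesis by (simp add: x_def flip: exp_add)
  qed
  also have "N\<^sup>2 * exp (2 * (\<theta> * (c * c' / N\<^sup>2)) - S) = exp (2 * ln N - \<theta> / N\<^sup>2)"
  proof -
    have 1: "2 * (\<theta> * (c * c' / N\<^sup>2)) - S = - (\<theta> / N\<^sup>2)"
      unfolding S_def by (simp add: algebra_simps add_divide_distrib)
    have 2: "exp (2 * ln N) = N\<^sup>2" using N exp_of_nat_mult[of 2 "ln N"] by simp
    show ?thesis unfolding 1 by (simp add: exp_diff 2 exp_minus divide_inverse)
  qed
  \<comment> \<open>The union over pairs of leaders costs \<open>2 * ln N\<close>, while the first
    rate makes \<open>\<theta> / N\<^sup>2\<close> at least \<open>4 * ln N\<close>.\<close>
  also have "exp (2 * ln N - \<theta> / N\<^sup>2) \<le> exp (- ln N)"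
  proof -
    have "N\<^sup>2 * ln N * 4 \<le> \<theta>" using rate1 \<theta> by (simp add: N_def \<theta>_def field_simps)
    then have "ln N * 4 \<le> \<theta> / N\<^sup>2" using N by (simp add: pos_le_divide_eq mult_ac)
    then show ?thesis using lnN by simp
  qed
  also have "exp (- ln N) = 1 / N" using N by (simp add: exp_minus field_simps)
  finally show ?thesis by (simp add: N_def \<theta>_def)
qed

section \<open>Passage to the limit along the sequence\<close>

theorem theorem4:
  fixes M :: "nat \<Rightarrow> 'a measure"
    and nL n T :: "nat \<Rightarrow> nat"
    and \<rho> :: "nat \<Rightarrow> nat \<Rightarrow> real"
    and A :: "nat \<Rightarrow> nat \<Rightarrow> nat \<Rightarrow> real"
    and Z Zhat :: "nat \<Rightarrow> nat \<Rightarrow> 'a \<Rightarrow> nat"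
    and G :: "nat \<Rightarrow> nat \<Rightarrow> nat \<Rightarrow> 'a \<Rightarrow> bool"
    and d v :: "nat \<Rightarrow> real"
    and c_min c_max c\<^sub>0 :: real
  assumes model:
      "\<And>m. asymmetric_hub_model (M m) (nL m) (n m) (T m) (\<rho> m) (A m) (Z m) (G m)"
    and Zhat_measurable:
      "\<And>m t. t \<in> {1..T m} \<Longrightarrow> Zhat m t \<in> measurable (M m) (count_space UNIV)"
    and Zhat_mle:
      "\<And>m. AE \<omega> in M m.
         is_profile_mle (nL m) (n m) (T m) (\<lambda>t j. G m t j \<omega>) (\<lambda>t. Zhat m t \<omega>)"
    and nL_lim: "filterlim nL at_top sequentially"
    and n_lim: "filterlim n at_top sequentially"
    and T_lim: "filterlim T at_top sequentially"
    and c_min_pos: "c_min > 0"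
    and c_max_pos: "c_max > 0"
    and rho_min: "\<And>m. (MIN i\<in>{1..nL m}. \<rho> m i) = c_min / real (nL m)"
    and rho_max: "\<And>m. (MAX i\<in>{1..nL m}. \<rho> m i) = c_max / real (nL m)"
    and d_range: "\<And>m. d m \<in> {0<..1}"
    and v_range: "\<And>m. v m \<in> {0<..1}"
    and separation:
      "\<And>m i. i \<in> {1..nL m} \<Longrightarrow>
         \<exists>V \<subseteq> {1..n m}. real (card V) \<ge> v m * real (n m) / real (nL m) \<and>
           (\<forall>j\<in>V. \<forall>i'\<in>{1..nL m}. i' \<noteq> i \<longrightarrow> A m i j - A m i' j \<ge> d m)"
    and c0_pos: "c\<^sub>0 > 0"
    and leader_sparsity:
      "\<And>m i i'. i \<in> {1..nL m} \<Longrightarrow> i' \<in> {1..nL m} \<Longrightarrow> i \<noteq> i' \<Longrightarrow>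
         A m i i' \<le> c\<^sub>0 / real (nL m)"
    and rate1:
      "(\<lambda>m. (real (nL m))\<^sup>2 * ln (real (nL m)) / real (T m)) \<in> o(\<lambda>_. 1)"
    and rate2:
      "(\<lambda>m. (real (nL m))\<^sup>2 * ln (real (T m)) / ((d m)\<^sup>2 * v m * real (T m))) \<in> o(\<lambda>_. 1)"
    and rate3:
      "(\<lambda>m. (real (nL m))\<^sup>2 * ln (real (nL m)) / ((d m)^4 * (v m)\<^sup>2 * real (n m)))
         \<in> o(\<lambda>_. 1)"
  shows "small_op_one M
           (\<lambda>m \<omega>. real (mislabeled (T m) (\<lambda>t. Z m t \<omega>) (\<lambda>t. Zhat m t \<omega>)) / real (T m))"
  unfolding small_op_one_def
proof (intro allI impI)
  fix \<epsilon> :: real assume \<epsilon>: "0 < \<epsilon>"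
  let ?P = "\<lambda>m. \<P>(\<omega> in M m.
    \<epsilon> < \<bar>real (mislabeled (T m) (\<lambda>t. Z m t \<omega>) (\<lambda>t. Zhat m t \<omega>)) / real (T m)\<bar>)"
  let ?r1 = "\<lambda>m. (real (nL m))\<^sup>2 * ln (real (nL m)) / real (T m)"
  let ?r2 = "\<lambda>m. (real (nL m))\<^sup>2 * ln (real (T m)) / ((d m)\<^sup>2 * v m * real (T m))"
  let ?r3 = "\<lambda>m. (real (nL m))\<^sup>2 * ln (real (nL m)) / ((d m)^4 * (v m)\<^sup>2 * real (n m))"
  let ?c = "2 * (2 * (c_max * c\<^sub>0) + 1)"
  have lims: "?r1 \<longlonglongrightarrow> 0" "?r2 \<longlonglongrightarrow> 0" "?r3 \<longlonglongrightarrow> 0"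
    using rate1 rate2 rate3 by (simp_all add: smalloD_tendsto[where g = "\<lambda>_. 1", simplified])
  have inv_nL: "(\<lambda>m. K / real (nL m)) \<longlonglongrightarrow> 0" for K
    by (intro real_tendsto_divide_at_top[OF tendsto_const] filterlim_compose[OF filterlim_real_sequentially nL_lim])
  have "(\<lambda>m. ?c / real (nL m) + 64 * ?r2 m + 32 * ?r3 m) \<longlonglongrightarrow> 0 + 64 * 0 + 32 * 0"
    by (intro tendsto_intros inv_nL lims)
  then have ev_\<tau>: "\<forall>\<^sub>F m in sequentially. ?c / real (nL m) + 64 * ?r2 m + 32 * ?r3 m < \<epsilon>"
    using \<epsilon> by (intro order_tendstoD) auto
  have ev_r1: "\<forall>\<^sub>F m in sequentially. ?r1 m < 1 / 4"
    using lims(1) by (intro order_tendstoD) auto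
  have ev_nL: "\<forall>\<^sub>F m in sequentially. 3 \<le> nL m" and ev_T: "\<forall>\<^sub>F m in sequentially. 2 \<le> T m"
    using nL_lim T_lim by (auto simp: filterlim_at_top)
  \<comment> \<open>The right side is free of \<open>\<epsilon>\<close>; the choice of
    \<open>\<epsilon>\<close> only affects from which index on the bound holds.\<close>
  have bound: "\<forall>\<^sub>F m in sequentially. ?P m \<le> exp (- real (T m)) + 1 / real (nL m)"
    using ev_\<tau> ev_r1 ev_nL ev_T
  proof eventually_elim
    case (elim m)
    interpret asymmetric_hub_model "M m" "nL m" "n m" "T m" "\<rho> m" "A m" "Z m" "G m"
      by (rule model)
    have "\<rho> m k \<le> c_max / real (nL m)" if "k \<in> {1..nL m}" for k
      using that unfolding rho_max[symmetric] by (intro Max_ge) auto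
    then have "prob {\<omega> \<in> space (M m).
          \<epsilon> < real (mislabeled (T m) (\<lambda>t. Z m t \<omega>) (\<lambda>t. Zhat m t \<omega>)) / real (T m)}
        \<le> exp (- real (T m)) + 1 / real (nL m)"
      using elim c_max_pos c0_pos leader_sparsity separation
      by (intro mislabeled_fraction_tail[where c = c_max and c' = "c\<^sub>0" and v = "v m" and d = "d m"]
          Zhat_mle d_range v_range) auto
    then show ?case by simp
  qed
  have "(\<lambda>m. exp (- real (T m))) \<longlonglongrightarrow> 0"
    by (intro filterlim_compose[OF exp_at_bot] filterlim_compose[OF filterlim_uminus_at_bot_at_top]
        filterlim_compose[OF filterlim_real_sequentially T_lim])
  from tendsto_add[OF this inv_nL[of 1]]
  have "(\<lambda>m. exp (- real (T m)) + 1 / real (nL m)) \<longlonglongrightarrow> 0" by simp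
  with bound show "?P \<longlonglongrightarrow> 0"
    by (intro tendsto_sandwich[OF _ bound tendsto_const]) auto
qed

end
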